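(* Let $\nu$ be a finite positive Borel measure on $[0,1]$, let $c_\nu\in[1,2]$ be its critical index and $c_\nu'$ the dual exponent of $c_\nu$. Suppose that $1<p<c_\nu'$, and let $q$ satisfy $\frac1q=\frac1p+\frac1{c_\nu}-1$. Then the following hold. (a) If $1\le c_\nu<2$, the following conditions are equivalent: (1) $T_\nu:L^p(\mathbb D)\to L^{q,\infty}(\mathbb D)$ is bounded; (2) $T_\nu:L^p(\mathbb D)\to L^q(\mathbb D)$ is bounded; (3) $\nu$ satisfies the $2/c_\nu'$-Carleson condition. (b) If $c_\nu=2$ (whence $1<p<2$ and $q=\frac{2p}{2-p}$), the following conditions are equivalent: (1) $T_\nu:L^p(\mathbb D)\to L^{q,\infty}(\mathbb D)$ is bounded; (2) $T_\nu:L^p(\mathbb D)\to L^q(\mathbb D)$ is bounded; (3) $\nu$ is integrable with respect to the hyperbolic arc length on $[0,1)$.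
   Context: $\mathbb D$ is the open unit disk in $\mathbb C$, $dA$ is the Lebesgue area measure normalized so that $A(\mathbb D)=1$, $|E|$ denotes the normalized area of $E$, and $L^p(\mathbb D)=L^p(\mathbb D,dA)$. For a finite positive Borel measure $\nu$ on $[0,1]$, $$T_\nu f(z)=\int_{\mathbb D}\frac{1}{1-z\overline\lambda}\left(\int_0^1\frac{d\nu(r)}{1-rz\overline\lambda}\right)f(\lambda)\,dA(\lambda),\quad z\in\mathbb D.$$ The critical index is $$c_\nu=\sup\left\{1\le c<2:\ \int_0^1\frac{1}{(1-r^2)^{2/c'}}\,d\nu(r)<\infty\right\},$$ where $c'$ denotes the dual exponent, $1/c+1/c'=1$ (with $1'=\infty$, $1/\infty=0$). For $1\le p<\infty$, $L^{p,\infty}(\mathbb D)$ is the space of measurable $f$ with finite quasi-norm $\|f\|_{L^{p,\infty}(\mathbb D)}=\inf\{C>0:\ |\{z\in\mathbb D:|f(z)|>t\}|\le C^p/t^p\ \text{for all } t>0\}$. For $\alpha\ge0$, $\nu$ satisfies the $\alpha$-Carleson condition if $\sup_{0<t\le1}\nu([1-t,1))/t^\alpha<\infty$ (for $\alpha=0$ this just says that $\nu$ is finite). $\nu$ is integrable with respect to the hyperbolic arc length on $[0,1)$ if $\int_{[0,1)}\frac{1}{1-r^2}\,d\nu(r)<\infty$. *)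

theory Defs
  imports "HOL-Analysis.Analysis"
begin

definition disc_area :: "complex measure" where
  "disc_area = uniform_measure (lebesgue_on (ball 0 1)) (ball 0 1)"

text \<open>The spaces below consist of functions rather than of classes modulo null sets; only the values
  on the unit disc matter, because \<^term>\<open>space disc_area\<close> is the disc.\<close>

definition Lp_disc :: "real \<Rightarrow> (complex \<Rightarrow> complex) set" where
  "Lp_disc p = {f \<in> borel_measurable disc_area. integrable disc_area (\<lambda>z. norm (f z) powr p)}"

definition Lp_norm :: "real \<Rightarrow> (complex \<Rightarrow> complex) \<Rightarrow> real" where
  "Lp_norm p f = (LINT z|disc_area. norm (f z) powr p) powr (1 / p)"

definition weak_bounds :: "real \<Rightarrow> (complex \<Rightarrow> complex) \<Rightarrow> real set" where
  "weak_bounds p f =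
     {C. 0 < C \<and> (\<forall>t>0. measure disc_area {z \<in> ball 0 1. t < norm (f z)} \<le> C powr p / t powr p)}"

text \<open>A finite quasi-norm means that the set of admissible constants is nonempty; the infimum of the
  empty set of reals carries no meaning.\<close>

definition weak_Lp_disc :: "real \<Rightarrow> (complex \<Rightarrow> complex) set" where
  "weak_Lp_disc p = {f \<in> borel_measurable disc_area. weak_bounds p f \<noteq> {}}"

definition weak_Lp_norm :: "real \<Rightarrow> (complex \<Rightarrow> complex) \<Rightarrow> real" where
  "weak_Lp_norm p f = Inf (weak_bounds p f)"

definition bounded_Lp_Lq :: "((complex \<Rightarrow> complex) \<Rightarrow> complex \<Rightarrow> complex) \<Rightarrow> real \<Rightarrow> real \<Rightarrow> bool" where
  "bounded_Lp_Lq T p q \<longleftrightarrow>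
     (\<exists>C. \<forall>f\<in>Lp_disc p. T f \<in> Lp_disc q \<and> Lp_norm q (T f) \<le> C * Lp_norm p f)"

definition bounded_Lp_weak_Lq :: "((complex \<Rightarrow> complex) \<Rightarrow> complex \<Rightarrow> complex) \<Rightarrow> real \<Rightarrow> real \<Rightarrow> bool" where
  "bounded_Lp_weak_Lq T p q \<longleftrightarrow>
     (\<exists>C. \<forall>f\<in>Lp_disc p. T f \<in> weak_Lp_disc q \<and> weak_Lp_norm q (T f) \<le> C * Lp_norm p f)"

definition T_op :: "real measure \<Rightarrow> (complex \<Rightarrow> complex) \<Rightarrow> complex \<Rightarrow> complex" where
  "T_op \<nu> f z =
     (LINT w|disc_area. 1 / (1 - z * cnj w) * (LINT r|\<nu>. 1 / (1 - of_real r * z * cnj w)) * f w)"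

definition dual_exponent :: "real \<Rightarrow> ereal" where
  "dual_exponent c = (if c = 1 then \<infinity> else ereal (c / (c - 1)))"

lemma dual_exponent_eq:
  assumes "1 \<le> c"
  shows "1 / ereal c + 1 / dual_exponent c = 1"
  using assms by (auto simp: dual_exponent_def one_ereal_def field_simps)

text \<open>The value $2/c'$, which is $0$ for $c = 1$.\<close>

definition two_over_dual :: "real \<Rightarrow> real" where
  "two_over_dual c = real_of_ereal (2 / dual_exponent c)"

text \<open>The function $(1-r^2)^{-s}$ on $[0,1]$. At $r = 1$ it is $\infty$ for $s > 0$, so that an atom of the
  measure at $1$ is seen, and $1$ for $s = 0$. The case distinction is needed because
  \<^term>\<open>0 powr 0 = (0::real)\<close>.\<close>

definition radial_weight :: "real \<Rightarrow> real \<Rightarrow> ennreal" where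
  "radial_weight s r = (if s = 0 then 1 else 1 / ennreal ((1 - r\<^sup>2) powr s))"

definition critical_index :: "real measure \<Rightarrow> real" where
  "critical_index \<nu> =
     Sup {c. 1 \<le> c \<and> c < 2 \<and> (\<integral>\<^sup>+ r. radial_weight (two_over_dual c) r \<partial>\<nu>) < \<infinity>}"

lemma critical_index_bounds:
  assumes "finite_measure \<nu>"
  shows "1 \<le> critical_index \<nu>" "critical_index \<nu> \<le> 2"
proof -
  let ?S = "{c. 1 \<le> c \<and> c < 2 \<and> (\<integral>\<^sup>+ r. radial_weight (two_over_dual c) r \<partial>\<nu>) < \<infinity>}"
  have "1 \<in> ?S"
    using finite_measure.emeasure_finite[OF assms, of "space \<nu>"]
    by (simp add: radial_weight_def two_over_dual_def dual_exponent_def less_top)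
  moreover have "bdd_above ?S"
    by (auto intro: bdd_aboveI[of _ 2])
  ultimately show "1 \<le> critical_index \<nu>"
    unfolding critical_index_def by (rule cSup_upper)
  show "critical_index \<nu> \<le> 2"
    unfolding critical_index_def
  proof (rule cSup_least)
    show "?S \<noteq> {}"
      using \<open>1 \<in> ?S\<close> by blast
  qed simp
qed

definition carleson_condition :: "real \<Rightarrow> real measure \<Rightarrow> bool" where
  "carleson_condition \<alpha> \<nu> \<longleftrightarrow> (SUP t\<in>{0<..1}. emeasure \<nu> {1 - t..<1} / ennreal (t powr \<alpha>)) < \<infinity>"

definition hyperbolic_integrable :: "real measure \<Rightarrow> bool" where
  "hyperbolic_integrable \<nu> \<longleftrightarrow> (\<integral>\<^sup>+ r\<in>{0..<1}. ennreal (1 / (1 - r\<^sup>2)) \<partial>\<nu>) < \<infinity>"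

end

theory Submission
  imports Defs "HOL-Complex_Analysis.Cauchy_Integral_Formula"
begin

text \<open>
  Everything is controlled by the Stieltjes transform
  $N(t) = \int_{[0,1]} \frac{d\nu(r)}{1-r+t}$ of the measure. For every $c \in [1,2]$ and every
  $p > 1$ with $\frac1q = \frac1p + \frac1c - 1 > 0$, weak boundedness, strong boundedness and the
  growth condition $N(t) \le B\,t^{1-2/c}$ for $0 < t \le 1$ are equivalent. It remains to translate
  the growth condition.

  From weak type to growth (\<open>Stieltjes_growth_of_weak_type\<close>): test the operator on the
  indicator of the disc $E$ with centre $1-t$ and radius $t/20$. For $z, w \in E$ the numbers
  $1 - z\overline w$ and $1 - rz\overline w$ differ by at most a tenth from the positive numbers
  $1-(1-t)^2$ and $1-r(1-t)^2$, so that the real part of the kernel is at least $N(t)/(8t)$ and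
  $|T_\nu 1_E|$ is at least a constant times $t N(t)$ on $E$. Since $|E|$ is
  comparable to $t^2$, the weak type inequality is the growth condition.

  From growth to strong type (\<open>bounded_of_Stieltjes_growth\<close>): as $|1-r\zeta|$ dominates
  $1-r+|1-\zeta|$, growth bounds the kernel by a multiple of $|1-z\overline w|^{-2/c}$. A Schur test
  with the weight $\rho(z) = 1-|z|^2$ handles this kernel. Put $P = |1-z\overline w|^{-2}$,
  $\kappa = 1 - \frac1p$ and $\iota = \frac1q$, so that the kernel is at most a multiple of
  $P^{\iota+\kappa}$. Hoelder's inequality for three factors splits $P^{\iota+\kappa}|f|$ into
  $(P\rho^{\kappa}|f|^p)^{\iota} \, (|f|^p)^{1-1/c} \, (P\rho^{-\iota})^{\kappa}$.
  The last factor, and the first one after integration in $z$, are estimated by the Forelli--Rudin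
  inequality $\int P(z,w)\rho(w)^{-s}\,dA(w) \le C_s\,\rho(z)^{-s}$ for $0<s<1$, where $s = \iota$ and
  $s = \kappa$ (\<open>Forelli_Rudin_bound\<close>). That inequality follows from the mean of the Poisson
  kernel over circles, the rotation invariance of area, and the fact that $|w|^2$ is uniformly
  distributed on $[0,1]$.

  Translation: if $c_\nu > 1$, then $\nu$ has no atom at $1$. For $1 < c < 2$ growth is equivalent to
  the $(2-2/c)$-Carleson condition, by a dyadic decomposition of $[0,1)$ in one direction and by
  Chebyshev's inequality in the other. For $c = 1$ both conditions hold for all finite measures. For
  $c = 2$ growth means that $N$ is bounded, which is hyperbolic integrability by Fatou's lemma.
\<close>

section \<open>Normalised area on the unit disc\<close>

lemma lborel_distr_uminus_euclidean:
  "distr lborel borel uminus = (lborel :: 'a::euclidean_space measure)"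
proof -
  have "lborel = density (distr lborel borel (\<lambda>x::'a. 0 + (-1) *\<^sub>R x)) (\<lambda>_. ennreal (\<bar>-1\<bar>^DIM('a)))"
    by (rule lborel_affine) auto
  then show ?thesis
    by (simp add: density_1 one_ennreal_def[symmetric])
qed

text \<open>
  The uniqueness of Haar measure in product form: by Fubini, translation in one variable
  at a time, and the reflection $y \mapsto -y$,
  $M(A)\,|B| = \iint 1_A(x)\,1_B(x+y)\,dM(x)\,dy = \iint 1_A(x-y)\,1_B(x)\,dM(x)\,dy = M(B)\,|A|$.
\<close>
lemma emeasure_proportional_of_translation_invariant:
  fixes M :: "'a::euclidean_space measure"
  assumes [measurable_cong]: "sets M = sets borel"
    and "sigma_finite_measure M"
    and trans: "\<And>c. distr M borel ((+) c) = M"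
    and A[measurable]: "A \<in> sets borel" and B[measurable]: "B \<in> sets borel"
  shows "emeasure M A * emeasure lborel B = emeasure M B * emeasure lborel A"
proof -
  interpret M: sigma_finite_measure M by fact
  interpret P: pair_sigma_finite M "lborel :: 'a measure" ..
  have shift: "(\<integral>\<^sup>+x. g (c + x) \<partial>N) = (\<integral>\<^sup>+x. g x \<partial>N)"
    if N: "distr N borel ((+) c) = N" and s: "sets N = sets borel" and [measurable]: "g \<in> borel_measurable borel"
    for g :: "'a \<Rightarrow> ennreal" and c :: 'a and N :: "'a measure"
  proof -
    have [measurable_cong]: "sets N = sets borel" by fact
    have "(\<integral>\<^sup>+x. g x \<partial>N) = (\<integral>\<^sup>+x. g x \<partial>distr N borel ((+) c))" by (simp add: N)
    also have "\<dots> = (\<integral>\<^sup>+x. g (c + x) \<partial>N)" by (subst nn_integral_distr) auto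
    finally show ?thesis ..
  qed
  have refl: "(\<integral>\<^sup>+x. g (- x) \<partial>lborel) = (\<integral>\<^sup>+x. g x \<partial>lborel)" if [measurable]: "g \<in> borel_measurable borel"
    for g :: "'a \<Rightarrow> ennreal"
  proof -
    have "(\<integral>\<^sup>+x. g x \<partial>lborel) = (\<integral>\<^sup>+x. g x \<partial>distr lborel borel uminus)"
      by (simp add: lborel_distr_uminus_euclidean)
    also have "\<dots> = (\<integral>\<^sup>+x. g (- x) \<partial>lborel)" by (subst nn_integral_distr) auto
    finally show ?thesis ..
  qed
  have "emeasure M A * emeasure lborel B = (\<integral>\<^sup>+x. indicator A x * emeasure lborel B \<partial>M)"
    by (subst nn_integral_multc) auto
  also have "\<dots> = (\<integral>\<^sup>+x. (\<integral>\<^sup>+y. indicator A x * indicator B y \<partial>lborel) \<partial>M)"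
    by (subst nn_integral_cmult) auto
  also have "\<dots> = (\<integral>\<^sup>+x. (\<integral>\<^sup>+y. indicator A x * indicator B (x + y) \<partial>lborel) \<partial>M)"
    by (intro nn_integral_cong shift[OF lborel_distr_plus, symmetric]) auto
  also have "\<dots> = (\<integral>\<^sup>+y. (\<integral>\<^sup>+x. indicator A x * indicator B (x + y) \<partial>M) \<partial>lborel)"
    by (rule P.Fubini'[symmetric]) measurable
  also have "\<dots> = (\<integral>\<^sup>+y. (\<integral>\<^sup>+x. indicator A (-y + (y + x)) * indicator B (y + x) \<partial>M) \<partial>lborel)"
    by (simp add: add_ac)
  also have "\<dots> = (\<integral>\<^sup>+y. (\<integral>\<^sup>+x. indicator A (-y + x) * indicator B x \<partial>M) \<partial>lborel)"
    by (intro nn_integral_cong shift[OF trans, where g="\<lambda>x. indicator A (-_ + x) * indicator B x"])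
       (auto simp: assms)
  also have "\<dots> = (\<integral>\<^sup>+x. (\<integral>\<^sup>+y. indicator A (-y + x) * indicator B x \<partial>lborel) \<partial>M)"
    by (rule P.Fubini') measurable
  also have "\<dots> = (\<integral>\<^sup>+x. (\<integral>\<^sup>+y. indicator A (x + y) * indicator B x \<partial>lborel) \<partial>M)"
    by (subst (2) add.commute, intro nn_integral_cong refl[where g="\<lambda>y. indicator A (y + _) * indicator B _"]) auto
  also have "\<dots> = (\<integral>\<^sup>+x. (\<integral>\<^sup>+y. indicator A y * indicator B x \<partial>lborel) \<partial>M)"
    by (intro nn_integral_cong shift[OF lborel_distr_plus, where g="\<lambda>y. indicator A y * indicator B _"]) auto
  also have "\<dots> = (\<integral>\<^sup>+x. emeasure lborel A * indicator B x \<partial>M)"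
    by (subst nn_integral_multc) auto
  also have "\<dots> = emeasure M B * emeasure lborel A"
    by (subst nn_integral_cmult) (auto simp: mult.commute)
  finally show ?thesis .
qed

text \<open>
  The image of area under a rotation is translation invariant and agrees with area on the unit disc,
  so the constant of proportionality is one.
\<close>
lemma lborel_distr_mult_unit:
  fixes u :: complex
  assumes u: "norm u = 1"
  shows "distr lborel borel ((*) u) = (lborel :: complex measure)"
proof (rule measure_eqI)
  let ?M = "distr lborel borel ((*) u) :: complex measure"
  have u0: "u \<noteq> 0" using u by auto
  have ball: "(*) u -` ball 0 1 = ball 0 1"
    using u by (auto simp: norm_mult)
  have e: "emeasure ?M A = emeasure lborel ((*) u -` A)" if "A \<in> sets borel" for A
    using that by (subst emeasure_distr) auto
  have pos: "emeasure lborel (ball (0::complex) 1) = ennreal pi"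
    by (simp add: emeasure_ball unit_ball_vol_2)
  have tr: "distr ?M borel ((+) c) = ?M" for c
  proof -
    have "distr ?M borel ((+) c) = distr lborel borel (\<lambda>x. u * (x + inverse u * c))"
      using u0 by (subst distr_distr) (auto simp: o_def algebra_simps)
    also have "\<dots> = distr (distr lborel borel ((+) (inverse u * c))) borel ((*) u)"
      by (subst distr_distr) (auto simp: o_def algebra_simps)
    also have "\<dots> = ?M" by (simp add: lborel_distr_plus)
    finally show ?thesis .
  qed
  have sf: "sigma_finite_measure ?M"
  proof
    let ?F = "range (\<lambda>n::nat. ball 0 (real n)) :: complex set set"
    have "emeasure ?M a \<noteq> \<infinity>" if "a \<in> ?F" for a
    proof -
      from that obtain n :: nat where a: "a = ball 0 (real n)" by auto
      have "(*) u -` a = a" using u by (auto simp: a norm_mult)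
      then show ?thesis by (subst e) (auto simp: a emeasure_ball)
    qed
    moreover have "\<Union>?F = UNIV"
      by (auto simp: reals_Archimedean2)
    ultimately show "\<exists>A. countable A \<and> A \<subseteq> sets ?M \<and> \<Union>A = space ?M \<and> (\<forall>a\<in>A. emeasure ?M a \<noteq> \<infinity>)"
      by (intro exI[of _ ?F]) auto
  qed
  fix A assume "A \<in> sets ?M"
  then have A: "A \<in> sets borel" by simp
  have "emeasure ?M A * emeasure lborel (ball (0::complex) 1) = emeasure ?M (ball 0 1) * emeasure lborel A"
    by (rule emeasure_proportional_of_translation_invariant[of ?M A "ball 0 1"]) (use tr sf A in auto)
  also have "emeasure ?M (ball 0 1) = ennreal pi" by (subst e) (auto simp: ball pos)
  finally show "emeasure ?M A = emeasure lborel A"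
    by (simp only: pos mult.commute[of "ennreal pi"]) (auto simp: ennreal_mult_cancel_left mult.commute[of _ "ennreal pi"])
qed simp

lemma space_disc_area[simp]: "space disc_area = ball 0 1"
  by (simp add: disc_area_def)

lemma sets_disc_area[measurable_cong]: "sets disc_area = sets (lebesgue_on (ball 0 1))"
  by (simp add: disc_area_def)

lemma emeasure_unit_disc: "emeasure (lebesgue_on (ball 0 1)) (ball (0::complex) 1) = ennreal pi"
  by (subst emeasure_restrict_space) (auto simp: emeasure_ball unit_ball_vol_2)

lemma borel_measurable_disc_area:
  "f \<in> borel_measurable borel \<Longrightarrow> f \<in> measurable disc_area borel"
  by (subst measurable_cong_sets[OF sets_disc_area refl])
     (intro measurable_restrict_space1 measurable_completion, simp)

lemma id_borel_measurable_disc_area[measurable]: "(\<lambda>z. z) \<in> measurable disc_area borel"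
  by (rule borel_measurable_disc_area) simp

lemma emeasure_disc_area_space: "emeasure disc_area (ball 0 1) = 1"
proof -
  have "ball (0::complex) 1 \<in> sets (lebesgue_on (ball 0 1))"
    by (auto simp: sets_restrict_space_iff)
  then show ?thesis
    unfolding disc_area_def
    by (subst emeasure_uniform_measure) (auto simp: emeasure_unit_disc divide_ennreal)
qed

interpretation disc_area: finite_measure disc_area
  by standard (simp add: emeasure_disc_area_space)

lemma borel_measurable_cnj[measurable]: "cnj \<in> borel_measurable borel"
  by (intro borel_measurable_continuous_onI continuous_intros)

lemma nn_integral_disc_area:
  assumes [measurable]: "f \<in> borel_measurable borel"
  shows "(\<integral>\<^sup>+z. f z \<partial>disc_area) = (\<integral>\<^sup>+z. f z * indicator (ball 0 1) z \<partial>lborel) / ennreal pi"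
proof -
  have [measurable]: "ball (0::complex) 1 \<in> sets borel" by simp
  have 1: "f \<in> borel_measurable (lebesgue_on (ball 0 1))"
    by (intro measurable_restrict_space1 measurable_completion) simp
  have 2: "ball (0::complex) 1 \<in> sets (lebesgue_on (ball 0 1))"
    by (auto simp: sets_restrict_space_iff)
  have "(\<integral>\<^sup>+z. f z \<partial>disc_area)
    = (\<integral>\<^sup>+z. f z * indicator (ball 0 1) z \<partial>lebesgue_on (ball 0 1)) / ennreal pi"
    unfolding disc_area_def by (subst nn_integral_uniform_measure[OF 1 2]) (simp add: emeasure_unit_disc)
  also have "(\<integral>\<^sup>+z. f z * indicator (ball 0 1) z \<partial>lebesgue_on (ball 0 1))
     = (\<integral>\<^sup>+z. f z * indicator (ball 0 1) z \<partial>lebesgue)"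
    by (subst nn_integral_restrict_space) (auto simp: indicator_def intro!: nn_integral_cong)
  also have "\<dots> = (\<integral>\<^sup>+z. f z * indicator (ball 0 1) z \<partial>lborel)"
    by (rule nn_integral_completion)
  finally show ?thesis .
qed

lemma nn_integral_disc_area_rotate:
  assumes [measurable]: "f \<in> borel_measurable borel" and u: "norm u = 1"
  shows "(\<integral>\<^sup>+z. f (u * z) \<partial>disc_area) = (\<integral>\<^sup>+z. f z \<partial>disc_area)"
proof -
  have [measurable]: "ball (0::complex) 1 \<in> sets borel" by simp
  have "(\<integral>\<^sup>+z. f z * indicator (ball 0 1) z \<partial>lborel)
    = (\<integral>\<^sup>+z. f z * indicator (ball 0 1) z \<partial>distr lborel borel ((*) u))"
    by (simp add: lborel_distr_mult_unit u)
  also have "\<dots> = (\<integral>\<^sup>+z. f (u * z) * indicator (ball 0 1) (u * z) \<partial>lborel)"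
    by (subst nn_integral_distr) auto
  also have "\<dots> = (\<integral>\<^sup>+z. f (u * z) * indicator (ball 0 1) z \<partial>lborel)"
    using u by (auto intro!: nn_integral_cong simp: indicator_def norm_mult)
  finally show ?thesis
    by (subst (1 2) nn_integral_disc_area) auto
qed

lemma ball_sets_disc_area: "ball a r \<subseteq> ball 0 1 \<Longrightarrow> ball a r \<in> sets disc_area"
proof -
  assume "ball a r \<subseteq> ball (0::complex) 1"
  then have "ball a r = ball a r \<inter> ball 0 1" by auto
  moreover have "ball a r \<inter> ball 0 1 \<in> sets (lebesgue_on (ball (0::complex) 1))"
    by (auto simp: sets_restrict_space_iff)
  ultimately show ?thesis by (simp add: sets_disc_area)
qed

lemma emeasure_disc_area_ball:
  assumes "ball a r \<subseteq> ball 0 1" "0 \<le> r"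
  shows "emeasure disc_area (ball a r) = ennreal (r\<^sup>2)"
proof -
  have i: "indicator (ball a r) z * indicator (ball 0 1) z = (indicator (ball a r) z :: ennreal)" for z
    using assms by (auto split: split_indicator)
  have "emeasure disc_area (ball a r) = (\<integral>\<^sup>+z. indicator (ball a r) z \<partial>disc_area)"
    using assms(1) by (intro nn_integral_indicator[symmetric] ball_sets_disc_area)
  also have "\<dots> = (\<integral>\<^sup>+z. indicator (ball a r) z \<partial>lborel) / ennreal pi"
    by (subst nn_integral_disc_area) (auto simp: i simp del: nn_integral_indicator intro!: borel_measurable_indicator)
  also have "\<dots> = ennreal (pi * r\<^sup>2) / ennreal pi"
    using assms by (simp add: emeasure_ball unit_ball_vol_2)
  also have "\<dots> = ennreal (r\<^sup>2)"
    by (subst divide_ennreal) auto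
  finally show ?thesis .
qed

lemma measure_disc_area_ball:
  "ball a r \<subseteq> ball 0 1 \<Longrightarrow> 0 \<le> r \<Longrightarrow> measure disc_area (ball a r) = r\<^sup>2"
  by (simp add: measure_def emeasure_disc_area_ball)

text \<open>
  The square of the modulus is uniformly distributed on the unit interval; this replaces integration
  in polar coordinates.
\<close>
lemma nn_integral_disc_area_radial:
  assumes [measurable]: "\<phi> \<in> borel_measurable borel"
  shows "(\<integral>\<^sup>+w. \<phi> ((norm w)\<^sup>2) \<partial>disc_area) = (\<integral>\<^sup>+u. \<phi> u * indicator {0..1} u \<partial>lborel)"
proof -
  define f where "f = (\<lambda>w::complex. (norm w)\<^sup>2)"
  have fm[measurable]: "f \<in> borel_measurable disc_area"
    unfolding f_def by measurable
  let ?N = "density lborel (indicator {0..1::real})"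
  have eq: "distr disc_area borel f = ?N"
  proof (rule measure_eqI_lessThan)
    fix x :: real
    let ?S = "{z \<in> ball (0::complex) 1. x < (norm z)\<^sup>2}"
    have e: "emeasure (distr disc_area borel f) {x<..} = emeasure disc_area ?S"
      by (subst emeasure_distr) (auto simp: f_def intro!: arg_cong[where f="emeasure disc_area"])
    show "emeasure (distr disc_area borel f) {x<..} < \<infinity>"

      unfolding e infinity_ennreal_def less_top[symmetric] by (intro disc_area.emeasure_finite)
    have e2: "emeasure ?N {x<..} = emeasure lborel ({0..1} \<inter> {x<..})"
      by (subst emeasure_density) (auto simp: nn_integral_indicator[symmetric] simp del: nn_integral_indicator intro!: nn_integral_cong simp: indicator_def)
    consider "x < 0" | "0 \<le> x" "x < 1" | "1 \<le> x" by linarith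
    then show "emeasure (distr disc_area borel f) {x<..} = emeasure ?N {x<..}"
    proof cases
      case 1
      then have "?S = space disc_area" "{0..1} \<inter> {x<..} = {0..1}"
        by (auto intro: less_le_trans)
      then show ?thesis unfolding e e2 by (simp add: emeasure_disc_area_space)
    next
      case 3
      then have "?S = {}" "{0..1} \<inter> {x<..} = {}"
        by (auto simp: power_le_one not_less intro: order_trans[rotated])
      then show ?thesis unfolding e e2 by (simp only: emeasure_empty)
    next
      case 2
      have "{0..1} \<inter> {x<..} = {x<..1}" using 2 by auto
      then have r: "emeasure ?N {x<..} = ennreal (1 - x)" unfolding e2 using 2 by simp
      have "emeasure disc_area ?S = (\<integral>\<^sup>+z. indicator {z. x < (norm z)\<^sup>2} z \<partial>disc_area)"
      proof -
        have "?S \<in> sets disc_area" using measurable_sets[OF fm, of "{x<..}"]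
          by (simp add: f_def vimage_def Int_def conj_commute)
        then have "emeasure disc_area ?S = (\<integral>\<^sup>+z. indicator ?S z \<partial>disc_area)" by simp
        also have "\<dots> = (\<integral>\<^sup>+z. indicator {z. x < (norm z)\<^sup>2} z \<partial>disc_area)"
          by (intro nn_integral_cong) (auto simp: indicator_def)
        finally show ?thesis .
      qed
      also have "\<dots> = (\<integral>\<^sup>+z. indicator (ball 0 1 - cball 0 (sqrt x)) (z::complex) \<partial>lborel) / ennreal pi"
      proof -
        have "sqrt x < norm z \<longleftrightarrow> x < (norm z)\<^sup>2" for z :: complex
          using real_sqrt_less_iff[of x "(norm z)\<^sup>2"] by simp
        then have "indicator {z. x < (norm z)\<^sup>2} z * indicator (ball 0 1) z
            = (indicator (ball 0 1 - cball 0 (sqrt x)) z :: ennreal)" for z :: complex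
          by (auto split: split_indicator simp: not_le)
        then show ?thesis
          by (subst nn_integral_disc_area) (auto simp del: nn_integral_indicator)
      qed
      also have "(\<integral>\<^sup>+z. indicator (ball 0 1 - cball 0 (sqrt x)) (z::complex) \<partial>lborel) = emeasure lborel (ball 0 1 - cball (0::complex) (sqrt x))"
        by simp
      also have "\<dots> = emeasure lborel (ball (0::complex) 1) - emeasure lborel (cball (0::complex) (sqrt x))"
      proof (rule emeasure_Diff)
        show "cball (0::complex) (sqrt x) \<subseteq> ball 0 1"
          using 2 by (subst cball_subset_ball_iff) auto
      qed (use 2 in \<open>auto simp: emeasure_cball\<close>)
      also have "\<dots> = ennreal (pi - pi * x)"
        using 2 by (simp add: emeasure_ball emeasure_cball unit_ball_vol_2 ennreal_minus)
      also have "\<dots> / ennreal pi = ennreal (1 - x)"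
        using 2 by (subst divide_ennreal) (auto simp: field_simps)
      finally show ?thesis unfolding e r .
    qed
  qed auto
  have "(\<integral>\<^sup>+w. \<phi> ((norm w)\<^sup>2) \<partial>disc_area) = (\<integral>\<^sup>+u. \<phi> u \<partial>distr disc_area borel f)"
    by (subst nn_integral_distr) (auto simp: f_def)
  also have "\<dots> = (\<integral>\<^sup>+u. \<phi> u * indicator {0..1} u \<partial>lborel)"
    unfolding eq by (subst nn_integral_density) (auto simp: mult.commute)
  finally show ?thesis .
qed

section \<open>The Forelli--Rudin estimate\<close>

text \<open>
  The integrand is the real part of the holomorphic function $\frac{1+a\zeta}{1-a\zeta}$ of
  $\zeta = e^{2\pi i t}$, divided by $1-|a|^2$, and that function has the value $1$ at the origin.
\<close>
lemma Poisson_kernel_mean: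
  fixes a :: complex
  assumes a: "norm a < 1"
  shows "(\<integral>\<^sup>+t. ennreal (1 / (norm (1 - a * exp (2 * pi * \<i> * of_real t)))\<^sup>2) * indicator {0..1} t \<partial>lborel)
    = ennreal (1 / (1 - (norm a)\<^sup>2))"
proof -
  define F where "F \<zeta> = (1 + a * \<zeta>) / (1 - a * \<zeta>)" for \<zeta>
  have ne: "1 - a * \<zeta> \<noteq> 0" if "norm \<zeta> \<le> 1" for \<zeta>
  proof
    assume "1 - a * \<zeta> = 0"
    then have "norm (a * \<zeta>) = 1" by simp
    moreover have "norm (a * \<zeta>) < 1"
      using mult_left_mono[OF that norm_ge_zero[of a]] a by (simp add: norm_mult)
    ultimately show False by simp
  qed
  have "F holomorphic_on cball 0 1"
    unfolding F_def using ne by (intro holomorphic_intros) auto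
  then have "((\<lambda>u. F u / (u - 0)) has_contour_integral (2 * of_real pi * \<i> * F 0)) (circlepath 0 1)"
    by (rule Cauchy_integral_circlepath_simple) simp
  note contour = this
  have c: "circlepath 0 1 t = exp (2 * pi * \<i> * of_real t)" for t
    by (simp add: circlepath)
  have "((\<lambda>t. F (exp (2 * pi * \<i> * of_real t)) * (2 * pi * \<i>)) has_integral (2 * of_real pi * \<i> * F 0)) {0..1}"
    by (rule has_integral_eq[OF _ contour[unfolded has_contour_integral_def]])
       (simp add: vector_derivative_circlepath01 c)
  note mean = this
  have m: "u * (of_real (2 * pi) * \<i>) * inverse (of_real (2 * pi) * \<i>) = u"
      "2 * of_real pi * \<i> * u * inverse (of_real (2 * pi) * \<i>) = u" for u :: complex
    by (simp_all add: field_simps)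
  have F0: "F 0 = 1" by (simp add: F_def)
  have "((\<lambda>t. F (exp (2 * pi * \<i> * of_real t)) * (2 * pi * \<i>) * inverse (2 * pi * \<i>)) has_integral (2 * of_real pi * \<i> * F 0 * inverse (2 * pi * \<i>))) {0..1}"
    by (rule has_integral_mult_left[OF mean])
  then have "((\<lambda>t. F (exp (2 * pi * \<i> * of_real t))) has_integral 1) {0..1}"
    by (simp only: m F0)
  then have "((\<lambda>t. Re (F (exp (2 * pi * \<i> * of_real t)))) has_integral 1) {0..1}"
    by (auto dest: has_integral_Re)
  then have "((\<lambda>t. Re (F (exp (2 * pi * \<i> * of_real t))) * (1 / (1 - (norm a)\<^sup>2))) has_integral (1 * (1 / (1 - (norm a)\<^sup>2)))) {0..1}"
    by (rule has_integral_mult_left)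
  moreover have "Re (F (exp (2 * pi * \<i> * of_real t))) * (1 / (1 - (norm a)\<^sup>2)) = 1 / (norm (1 - a * exp (2 * pi * \<i> * of_real t)))\<^sup>2" for t
  proof -
    define x where "x = a * exp (2 * pi * \<i> * of_real t)"
    have nx: "norm x = norm a" by (simp add: x_def norm_mult)
    have xne: "1 - x \<noteq> 0" using ne[of "exp (2 * pi * \<i> * of_real t)"] by (simp add: x_def)
    have "Re ((1 + x) / (1 - x)) = Re ((1 + x) * cnj (1 - x)) / (norm (1 - x))\<^sup>2"
      by (simp add: Re_complex_div_eq_0 complex_div_cnj[of "1+x"] del: complex_cnj_diff)
    also have "Re ((1 + x) * cnj (1 - x)) = 1 - ((Re x)\<^sup>2 + (Im x)\<^sup>2)"
      by (simp add: algebra_simps power2_eq_square)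
    also have "\<dots> = 1 - (norm x)\<^sup>2"
      by (simp add: cmod_power2)
    finally have "Re ((1 + x) / (1 - x)) = (1 - (norm a)\<^sup>2) / (norm (1 - x))\<^sup>2" by (simp add: nx)
    moreover have "1 - (norm a)\<^sup>2 \<noteq> 0" using a by (simp add: power2_eq_1_iff) (use norm_ge_zero[of a] in linarith)
    ultimately show ?thesis unfolding F_def x_def[symmetric] by simp
  qed
  ultimately have "((\<lambda>t. 1 / (norm (1 - a * exp (2 * pi * \<i> * of_real t)))\<^sup>2) has_integral (1 / (1 - (norm a)\<^sup>2))) {0..1}"
    by simp
  from nn_integral_has_integral_lebesgue'[OF _ this] show ?thesis
    by simp
qed

text \<open>Below $\delta$ the integrand is $x^{-s}/\delta$, and above it is $x^{-s-1}$.\<close>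

lemma nn_integral_powr_Stieltjes_bound:
  fixes s \<delta> :: real
  assumes s: "0 < s" "s < 1" and \<delta>: "0 < \<delta>"
  shows "(\<integral>\<^sup>+x. ennreal (x powr (- s) / max x \<delta>) * indicator {0..1} x \<partial>lborel)
     \<le> ennreal ((1 / (1 - s) + 1 / s) * \<delta> powr (- s))"
proof -
  have 1: "(\<integral>\<^sup>+x. ennreal (x powr (- s)) * indicator {0..\<delta>} x \<partial>lborel) = ennreal (\<delta> powr (1 - s) / (1 - s))"
    using nn_integral_has_integral_lebesgue'[OF _ has_integral_powr_from_0[of "-s" \<delta>]] s \<delta> by simp
  have 2: "(\<integral>\<^sup>+x. ennreal (x powr (- s - 1)) * indicator {\<delta>..} x \<partial>lborel) = ennreal (\<delta> powr (-s) / s)"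
    using nn_integral_has_integral_lebesgue'[OF _ has_integral_powr_to_inf[of "-s-1" \<delta>]] s \<delta> by simp
  have "(\<integral>\<^sup>+x. ennreal (x powr (- s) / max x \<delta>) * indicator {0..1} x \<partial>lborel)
     \<le> (\<integral>\<^sup>+x. ennreal (1 / \<delta>) * (ennreal (x powr (- s)) * indicator {0..\<delta>} x) + ennreal (x powr (- s - 1)) * indicator {\<delta>..} x \<partial>lborel)"
  proof (rule nn_integral_mono)
    fix x :: real
    consider "x < 0" | "0 \<le> x" "x < \<delta>" | "\<delta> \<le> x" by linarith
    then show "ennreal (x powr (- s) / max x \<delta>) * indicator {0..1} x \<le>
      ennreal (1 / \<delta>) * (ennreal (x powr (- s)) * indicator {0..\<delta>} x) + ennreal (x powr (- s - 1)) * indicator {\<delta>..} x"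
    proof cases
      case 2
      then show ?thesis using \<delta> by (auto split: split_indicator simp: ennreal_mult[symmetric])
    next
      case 3
      then have "x powr (-s) / max x \<delta> = x powr (- s - 1)"
        using \<delta> by (simp add: powr_diff)
      then have "ennreal (x powr (- s) / max x \<delta>) * indicator {0..1} x \<le> ennreal (x powr (- s - 1)) * indicator {\<delta>..} x"
        using 3 by (auto split: split_indicator)
      then show ?thesis by (rule order_trans) simp
    qed simp
  qed
  also have "\<dots> = ennreal (1 / \<delta>) * ennreal (\<delta> powr (1 - s) / (1 - s)) + ennreal (\<delta> powr (-s) / s)"
    by (subst nn_integral_add) (auto simp: nn_integral_cmult 1 2)
  also have "\<dots> = ennreal ((1 / \<delta>) * (\<delta> powr (1 - s) / (1 - s)) + \<delta> powr (-s) / s)"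
    using s \<delta> by (simp add: ennreal_mult[symmetric] ennreal_plus[symmetric] del: ennreal_plus)
  also have "(1 / \<delta>) * (\<delta> powr (1 - s) / (1 - s)) + \<delta> powr (-s) / s = (1 / (1 - s) + 1 / s) * \<delta> powr (- s)"
    using \<delta> s by (simp add: powr_diff powr_minus field_simps)
  finally show ?thesis .
qed

lemma norm_mult_cnj_less_1:
  assumes "norm z < 1" "norm w < 1" shows "norm (z * cnj w) < 1"
  using mult_strict_mono'[OF assms] by (simp add: norm_mult)

text \<open>
  Averaging over the rotations of $w$ replaces $|1-z\overline w|^{-2}$ by $(1-|zw|^2)^{-1}$. The
  integrand is then radial, and the substitution $x = 1-|w|^2$ leaves an integral over $[0,1]$.
\<close>
theorem Forelli_Rudin_bound:
  fixes s :: real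
  assumes s: "0 < s" "s < 1" and z: "norm z < 1"
  shows "(\<integral>\<^sup>+w. ennreal ((1 - (norm w)\<^sup>2) powr (- s) / (norm (1 - z * cnj w))\<^sup>2) \<partial>disc_area)
    \<le> ennreal ((1 / (1 - s) + 1 / s) * (1 - (norm z)\<^sup>2) powr (- s))"
proof -
  define g where "g w = ennreal ((1 - (norm w)\<^sup>2) powr (- s))" for w :: complex
  define e where "e t = exp (2 * pi * \<i> * of_real t)" for t :: real
  define k where "k a = ennreal (1 / (norm (1 - a))\<^sup>2)" for a :: complex
  have e[measurable]: "e \<in> borel_measurable borel"
    unfolding e_def by (intro borel_measurable_continuous_onI continuous_intros)
  have g[measurable]: "g \<in> borel_measurable borel" unfolding g_def by measurable
  have k[measurable]: "k \<in> borel_measurable borel" unfolding k_def by measurable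
  have gk: "ennreal ((1 - (norm w)\<^sup>2) powr (- s) / (norm (1 - z * cnj w))\<^sup>2) = g w * k (z * cnj w)" for w
    by (simp add: g_def k_def ennreal_mult[symmetric])
  interpret P: pair_sigma_finite disc_area "lborel :: real measure" ..
  have rot: "(\<integral>\<^sup>+w. g w * k (z * cnj w * e t) \<partial>disc_area) = (\<integral>\<^sup>+w. g w * k (z * cnj w) \<partial>disc_area)" for t
  proof -
    have n: "norm (cnj (e t)) = 1" by (simp add: e_def)
    have "(\<integral>\<^sup>+w. g w * k (z * cnj w) \<partial>disc_area) = (\<integral>\<^sup>+w. g (cnj (e t) * w) * k (z * cnj (cnj (e t) * w)) \<partial>disc_area)"
      by (rule nn_integral_disc_area_rotate[symmetric, OF _ n]) measurable
    also have "\<dots> = (\<integral>\<^sup>+w. g w * k (z * cnj w * e t) \<partial>disc_area)"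
      using n by (simp add: g_def norm_mult mult_ac)
    finally show ?thesis ..
  qed
  have d: "0 < 1 - (norm z)\<^sup>2" using z by (simp add: power_less_one_iff)
  have "(\<integral>\<^sup>+w. g w * k (z * cnj w) \<partial>disc_area)
    = (\<integral>\<^sup>+t. (\<integral>\<^sup>+w. g w * k (z * cnj w * e t) \<partial>disc_area) * indicator {0..1} t \<partial>lborel)"
    unfolding rot by (subst nn_integral_cmult_indicator) auto
  also have "\<dots> = (\<integral>\<^sup>+t. (\<integral>\<^sup>+w. g w * k (z * cnj w * e t) * indicator {0..1} t \<partial>disc_area) \<partial>lborel)"
    by (intro nn_integral_cong nn_integral_multc[symmetric]) measurable
  also have "\<dots> = (\<integral>\<^sup>+w. (\<integral>\<^sup>+t. g w * k (z * cnj w * e t) * indicator {0..1} t \<partial>lborel) \<partial>disc_area)"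
    by (rule P.Fubini') measurable
  also have "\<dots> = (\<integral>\<^sup>+w. g w * ennreal (1 / (1 - (norm (z * cnj w))\<^sup>2)) \<partial>disc_area)"
  proof (rule nn_integral_cong)
    fix w assume "w \<in> space disc_area"
    then have "norm (z * cnj w) < 1" using z by (auto intro: norm_mult_cnj_less_1)
    from Poisson_kernel_mean[OF this]
    show "(\<integral>\<^sup>+t. g w * k (z * cnj w * e t) * indicator {0..1} t \<partial>lborel) = g w * ennreal (1 / (1 - (norm (z * cnj w))\<^sup>2))"
      unfolding e_def[symmetric] k_def[symmetric]
      by (simp add: mult.assoc nn_integral_cmult)
  qed
  also have "\<dots> = (\<integral>\<^sup>+w. (\<lambda>u. ennreal ((1 - u) powr (-s) / (1 - (norm z)\<^sup>2 * u))) ((norm w)\<^sup>2) \<partial>disc_area)"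
    by (intro nn_integral_cong) (simp add: g_def ennreal_mult'[symmetric] norm_mult power_mult_distrib)
  also have "\<dots> = (\<integral>\<^sup>+u. ennreal ((1 - u) powr (-s) / (1 - (norm z)\<^sup>2 * u)) * indicator {0..1} u \<partial>lborel)"
    by (rule nn_integral_disc_area_radial) measurable
  also have "\<dots> = (\<integral>\<^sup>+x. ennreal (x powr (-s) / (1 - (norm z)\<^sup>2 * (1 - x))) * indicator {0..1} x \<partial>lborel)"
    by (subst nn_integral_real_affine[where t=1 and c="-1"])
       (auto intro!: nn_integral_cong split: split_indicator)
  also have "\<dots> \<le> (\<integral>\<^sup>+x. ennreal (x powr (-s) / max x (1 - (norm z)\<^sup>2)) * indicator {0..1} x \<partial>lborel)"
  proof (intro nn_integral_mono)
    fix x :: real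
    have "x powr (-s) / (1 - (norm z)\<^sup>2 * (1 - x)) \<le> x powr (-s) / max x (1 - (norm z)\<^sup>2)" if "0 \<le> x" "x \<le> 1"
    proof (intro divide_left_mono mult_pos_pos)
      have "(norm z)\<^sup>2 * (1 - x) \<le> 1 * (1 - x)" using d that by (intro mult_right_mono) auto
      moreover have "(norm z)\<^sup>2 * (1 - x) \<le> (norm z)\<^sup>2 * 1" using that by (intro mult_left_mono) auto
      ultimately show "max x (1 - (norm z)\<^sup>2) \<le> 1 - (norm z)\<^sup>2 * (1 - x)" by simp
      then show "0 < 1 - (norm z)\<^sup>2 * (1 - x)" using d by linarith
    qed (use d in auto)
    then show "ennreal (x powr (-s) / (1 - (norm z)\<^sup>2 * (1 - x))) * indicator {0..1} x
      \<le> ennreal (x powr (-s) / max x (1 - (norm z)\<^sup>2)) * indicator {0..1} x"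
      by (auto split: split_indicator intro!: ennreal_leI)
  qed
  also have "\<dots> \<le> ennreal ((1 / (1 - s) + 1 / s) * (1 - (norm z)\<^sup>2) powr (- s))"
    by (rule nn_integral_powr_Stieltjes_bound[OF s d])
  finally show ?thesis by (simp only: gk)
qed

section \<open>A three-factor Hoelder inequality\<close>

lemma powr_mult_powr_mult_powr_le:
  fixes x y z :: real
  assumes "0 \<le> x" "0 \<le> y" "0 \<le> z" and "0 \<le> \<alpha>" "0 \<le> \<beta>" "0 < \<gamma>" "\<alpha> + \<beta> + \<gamma> = 1"
  shows "x powr \<alpha> * y powr \<beta> * z powr \<gamma> \<le> \<alpha> * x + \<beta> * y + \<gamma> * z"
proof (cases "x = 0 \<or> y = 0 \<or> z = 0")
  case True
  then have "x powr \<alpha> * y powr \<beta> * z powr \<gamma> = 0" by auto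
  moreover have "0 \<le> \<alpha> * x + \<beta> * y + \<gamma> * z"
    using assms by (intro add_nonneg_nonneg mult_nonneg_nonneg) auto
  ultimately show ?thesis by linarith
next
  case False
  then have pos: "0 < x" "0 < y" "0 < z" using assms by auto
  define \<sigma> where "\<sigma> = \<beta> + \<gamma>"
  have \<sigma>: "0 < \<sigma>" using assms by (simp add: \<sigma>_def)
  have "y powr (\<beta> / \<sigma>) * z powr (\<gamma> / \<sigma>) \<le> \<beta> / \<sigma> * y + \<gamma> / \<sigma> * z"
    using assms pos \<sigma> by (intro Youngs_inequality_0) (auto simp: \<sigma>_def add_divide_distrib[symmetric])
  then have "\<sigma> * (y powr (\<beta> / \<sigma>) * z powr (\<gamma> / \<sigma>)) \<le> \<sigma> * (\<beta> / \<sigma> * y + \<gamma> / \<sigma> * z)"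
    using \<sigma> by (intro mult_left_mono) auto
  also have "\<dots> = \<beta> * y + \<gamma> * z"
    using \<sigma> by (simp add: field_simps)
  finally have "\<sigma> * (y powr (\<beta> / \<sigma>) * z powr (\<gamma> / \<sigma>)) \<le> \<beta> * y + \<gamma> * z" .
  moreover have "x powr \<alpha> * (y powr (\<beta> / \<sigma>) * z powr (\<gamma> / \<sigma>)) powr \<sigma>
      \<le> \<alpha> * x + \<sigma> * (y powr (\<beta> / \<sigma>) * z powr (\<gamma> / \<sigma>))"
    using assms pos \<sigma> by (intro Youngs_inequality_0) (auto simp: \<sigma>_def)
  moreover have "(y powr (\<beta> / \<sigma>) * z powr (\<gamma> / \<sigma>)) powr \<sigma> = y powr \<beta> * z powr \<gamma>"
    using \<sigma> by (simp add: powr_mult powr_powr)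
  ultimately show ?thesis by (simp add: mult.assoc)
qed

text \<open>
  The functions enter through their powers, so that $\alpha$, $\beta$, $\gamma$ are the reciprocals of
  the usual exponents. The value $\beta = 0$ is admitted because it occurs for $c = 1$.
\<close>
lemma nn_integral_Hoelder3:
  fixes a b d :: "'a \<Rightarrow> real"
  assumes [measurable]: "a \<in> borel_measurable M" "b \<in> borel_measurable M" "d \<in> borel_measurable M"
    and nonneg: "\<And>x. 0 \<le> a x" "\<And>x. 0 \<le> b x" "\<And>x. 0 \<le> d x"
    and ex: "0 \<le> \<alpha>" "0 \<le> \<beta>" "0 < \<gamma>" "\<alpha> + \<beta> + \<gamma> = 1"
    and A: "(\<integral>\<^sup>+x. ennreal (a x) \<partial>M) \<le> ennreal A" "0 < A"
    and B: "(\<integral>\<^sup>+x. ennreal (b x) \<partial>M) \<le> ennreal B" "0 < B"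
    and D: "(\<integral>\<^sup>+x. ennreal (d x) \<partial>M) \<le> ennreal D" "0 < D"
  shows "(\<integral>\<^sup>+x. ennreal (a x powr \<alpha> * b x powr \<beta> * d x powr \<gamma>) \<partial>M)
    \<le> ennreal (A powr \<alpha> * B powr \<beta> * D powr \<gamma>)"
proof -
  define S where "S = A powr \<alpha> * B powr \<beta> * D powr \<gamma>"
  have S: "0 \<le> S" by (simp add: S_def)
  have "(\<integral>\<^sup>+x. ennreal (a x powr \<alpha> * b x powr \<beta> * d x powr \<gamma>) \<partial>M)
    \<le> (\<integral>\<^sup>+x. ennreal S * (ennreal (\<alpha> / A) * ennreal (a x) + ennreal (\<beta> / B) * ennreal (b x) + ennreal (\<gamma> / D) * ennreal (d x)) \<partial>M)"
  proof (rule nn_integral_mono)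
    fix x
    have "a x powr \<alpha> * b x powr \<beta> * d x powr \<gamma>
      = S * ((a x / A) powr \<alpha> * (b x / B) powr \<beta> * (d x / D) powr \<gamma>)"
      using A B D nonneg by (simp add: S_def powr_divide field_simps)
    also have "\<dots> \<le> S * (\<alpha> * (a x / A) + \<beta> * (b x / B) + \<gamma> * (d x / D))"
      using ex A B D nonneg S by (intro mult_left_mono powr_mult_powr_mult_powr_le) auto
    finally have "ennreal (a x powr \<alpha> * b x powr \<beta> * d x powr \<gamma>)
      \<le> ennreal (S * (\<alpha> / A * a x + \<beta> / B * b x + \<gamma> / D * d x))"
      by (intro ennreal_leI) (simp add: field_simps)
    also have "\<dots> = ennreal S * (ennreal (\<alpha> / A) * ennreal (a x) + ennreal (\<beta> / B) * ennreal (b x) + ennreal (\<gamma> / D) * ennreal (d x))"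
      using ex A B D nonneg S by (simp add: ennreal_mult[symmetric] ennreal_plus[symmetric] del: ennreal_plus)
    finally show "ennreal (a x powr \<alpha> * b x powr \<beta> * d x powr \<gamma>) \<le> \<dots>" .
  qed
  also have "\<dots> = ennreal S * (ennreal (\<alpha> / A) * (\<integral>\<^sup>+x. a x \<partial>M) + ennreal (\<beta> / B) * (\<integral>\<^sup>+x. b x \<partial>M) + ennreal (\<gamma> / D) * (\<integral>\<^sup>+x. d x \<partial>M))"
    by (simp add: nn_integral_cmult nn_integral_add)
  also have "\<dots> \<le> ennreal S * (ennreal (\<alpha> / A) * ennreal A + ennreal (\<beta> / B) * ennreal B + ennreal (\<gamma> / D) * ennreal D)"
    using A B D by (intro mult_left_mono add_mono) auto
  also have "\<dots> = ennreal (S * (\<alpha> + \<beta> + \<gamma>))"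
    using ex A B D S by (simp add: ennreal_mult[symmetric] ennreal_plus[symmetric] del: ennreal_plus)
  finally show ?thesis using ex by (simp add: S_def)
qed

section \<open>The integral operator and its kernel\<close>

text \<open>The integral kernel of the operator with respect to normalised area.\<close>

definition T_kernel :: "real measure \<Rightarrow> complex \<Rightarrow> complex \<Rightarrow> complex" where
  "T_kernel \<nu> z w = 1 / (1 - z * cnj w) * (LINT r|\<nu>. 1 / (1 - of_real r * z * cnj w))"

lemma T_op_eq_T_kernel: "T_op \<nu> f z = (LINT w|disc_area. T_kernel \<nu> z w * f w)"
  by (simp add: T_op_def T_kernel_def)

text \<open>A finite Borel measure on the closed unit interval, an atom at $1$ being admitted.\<close>

locale unit_interval_measure =
  fixes \<nu> :: "real measure"
  assumes sets_nu: "sets \<nu> = sets (restrict_space borel {0..1})"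
    and finite_nu: "finite_measure \<nu>"
begin

sublocale finite_measure \<nu> by (rule finite_nu)

lemma space_nu: "space \<nu> = {0..1}"
  using sets_eq_imp_space_eq[OF sets_nu] by (simp add: space_restrict_space)

lemma borel_measurable_nu: "f \<in> borel_measurable borel \<Longrightarrow> f \<in> borel_measurable \<nu>"
  by (subst measurable_cong_sets[OF sets_nu refl]) (rule measurable_restrict_space1)

lemma id_borel_measurable_nu[measurable]: "(\<lambda>r. r) \<in> measurable \<nu> borel"
  by (rule borel_measurable_nu) simp

lemma T_op_measurable:
  assumes [measurable]: "f \<in> borel_measurable disc_area"
  shows "T_op \<nu> f \<in> borel_measurable disc_area"
proof -
  have "(\<lambda>z. LINT w|disc_area. T_kernel \<nu> z w * f w) \<in> borel_measurable disc_area"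
    unfolding T_kernel_def by measurable
  then show ?thesis by (simp add: T_op_eq_T_kernel[abs_def])
qed

end

lemma norm_one_minus_mult_cnj_commute: "norm (1 - z * cnj w) = norm (1 - w * cnj z)"
proof -
  have "norm (1 - z * cnj w) = norm (cnj (1 - z * cnj w))" by (simp only: complex_mod_cnj)
  then show ?thesis by (simp add: mult.commute)
qed

lemma norm_integral_le_nn_integral:
  fixes f :: "'a \<Rightarrow> 'b::{banach, second_countable_topology}"
  shows "ennreal (norm (integral\<^sup>L M f)) \<le> (\<integral>\<^sup>+x. ennreal (norm (f x)) \<partial>M)"
  by (cases "integrable M f") (auto simp: integral_norm_bound_ennreal not_integrable_integral_eq)

section \<open>Strong type from a pointwise bound of the kernel\<close>

text \<open>The radial weight $\rho(z) = 1-|z|^2$.\<close>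

definition Bergman_weight :: "complex \<Rightarrow> real" where
  "Bergman_weight z = 1 - (norm z)\<^sup>2"

text \<open>The modulus $P(z,w) = |1-z\overline w|^{-2}$ of the Bergman kernel.\<close>

definition Bergman_size :: "complex \<Rightarrow> complex \<Rightarrow> real" where
  "Bergman_size z w = 1 / (norm (1 - z * cnj w))\<^sup>2"

lemma Bergman_weight_pos: "norm z < 1 \<Longrightarrow> 0 < Bergman_weight z"
  by (simp add: Bergman_weight_def power_less_one_iff)

lemma one_minus_mult_cnj_nonzero:
  assumes "norm z < 1" "norm w < 1" shows "1 - z * cnj w \<noteq> 0"
  using norm_mult_cnj_less_1[OF assms] by auto

lemma Bergman_size_pos: "norm z < 1 \<Longrightarrow> norm w < 1 \<Longrightarrow> 0 < Bergman_size z w"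
  using one_minus_mult_cnj_nonzero[of z w] by (simp add: Bergman_size_def)

lemma Bergman_size_nonneg: "0 \<le> Bergman_size z w"
  by (simp add: Bergman_size_def)

lemma Bergman_weight_measurable[measurable]: "Bergman_weight \<in> borel_measurable borel"
  unfolding Bergman_weight_def[abs_def] by measurable

lemma Bergman_size_measurable[measurable (raw)]:
  assumes [measurable]: "f \<in> borel_measurable M" "g \<in> borel_measurable M"
  shows "(\<lambda>x. Bergman_size (f x) (g x)) \<in> borel_measurable M"
  unfolding Bergman_size_def[abs_def] by measurable

lemma Bergman_size_integral_bound:
  assumes "0 < s" "s < 1" "norm z < 1"
  shows "(\<integral>\<^sup>+w. ennreal (Bergman_size z w * Bergman_weight w powr (- s)) \<partial>disc_area)
    \<le> ennreal ((1 / (1 - s) + 1 / s) * Bergman_weight z powr (- s))"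
  using Forelli_Rudin_bound[OF assms] by (simp add: Bergman_size_def Bergman_weight_def)

lemma Bergman_size_integral_bound':
  assumes "0 < s" "s < 1" "norm w < 1"
  shows "(\<integral>\<^sup>+z. ennreal (Bergman_size z w * Bergman_weight z powr (- s)) \<partial>disc_area)
    \<le> ennreal ((1 / (1 - s) + 1 / s) * Bergman_weight w powr (- s))"
  using Bergman_size_integral_bound[OF assms]
  by (simp add: Bergman_size_def norm_one_minus_mult_cnj_commute[of _ w])

text \<open>
  The pointwise half of the Schur test. The right-hand integral may be infinite; where it vanishes,
  $f$ vanishes almost everywhere.
\<close>
lemma (in unit_interval_measure) T_op_pointwise_bound:
  fixes p q c B I :: real and f :: "complex \<Rightarrow> complex"
  assumes p: "1 < p" and c: "1 \<le> c" and q: "0 < q" "1 / q = 1 / p + 1 / c - 1" and B: "0 \<le> B"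
    and K: "\<And>w. norm w < 1 \<Longrightarrow> norm (T_kernel \<nu> z w) \<le> B * norm (1 - z * cnj w) powr (- 2 / c)"
    and f[measurable]: "f \<in> borel_measurable disc_area"
    and I: "(\<integral>\<^sup>+w. ennreal (norm (f w) powr p) \<partial>disc_area) \<le> ennreal I" "0 < I"
    and z: "norm z < 1"
  defines "\<iota> \<equiv> 1 / q" and "\<kappa> \<equiv> 1 - 1 / p" and "\<beta> \<equiv> 1 - 1 / c"
  shows "ennreal (norm (T_op \<nu> f z) powr q)
    \<le> ennreal ((B * I powr \<beta> * (1 / (1 - \<iota>) + 1 / \<iota>) powr \<kappa>) powr q * Bergman_weight z powr (- \<kappa>))
      * (\<integral>\<^sup>+w. ennreal (Bergman_size z w * Bergman_weight w powr \<kappa> * norm (f w) powr p) \<partial>disc_area)"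
    (is "_ \<le> ennreal (?C powr q * _) * ?J")
proof (cases "?J = \<infinity> \<or> B = 0")
  case True
  show ?thesis
  proof (cases "B = 0")
    case False
    with True B I z p have "?J = \<infinity>" "0 < Bergman_weight z powr (- \<kappa>)" "B \<noteq> 0"
      using Bergman_weight_pos[OF z] by auto
    moreover have "1 / (1 - \<iota>) + 1 / \<iota> > 0"
    proof -
      have "1 / p < 1" "1 / c \<le> 1" using p c by auto
      then have "\<iota> < 1" unfolding \<iota>_def using q(2) by linarith
      moreover have "0 < \<iota>" using q(1) by (simp add: \<iota>_def)
      ultimately show ?thesis by (intro add_pos_pos) auto
    qed
    ultimately have "0 < ?C powr q * Bergman_weight z powr (- \<kappa>)"
      using B I by simp
    then have "ennreal (?C powr q * Bergman_weight z powr (- \<kappa>)) \<noteq> 0"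
      unfolding ennreal_eq_0_iff not_le .
    then have "ennreal (?C powr q * Bergman_weight z powr (- \<kappa>)) * top = top"
      by (simp only: ennreal_mult_top if_False)
    then show ?thesis unfolding \<open>?J = \<infinity>\<close> infinity_ennreal_def by (simp only: top_greatest)
  next
    case B0: True
    have "T_op \<nu> f z = 0"
      unfolding T_op_eq_T_kernel using K B0
      by (intro integral_eq_zero_AE AE_I2) force
    then show ?thesis by simp
  qed
next
  case False
  then have B: "0 < B" using B by simp
  have "1 / p < 1" "1 / c \<le> 1" using p c by auto
  then have "1 / q < 1" using q(2) by linarith
  then have \<iota>: "0 < \<iota>" "\<iota> < 1" using q(1) by (auto simp: \<iota>_def)
  have \<kappa>: "0 < \<kappa>" "\<kappa> < 1" using p by (auto simp: \<kappa>_def)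
  have \<beta>: "0 \<le> \<beta>" using c by (simp add: \<beta>_def)
  have sum1: "\<iota> + \<beta> + \<kappa> = 1" using q by (simp add: \<iota>_def \<beta>_def \<kappa>_def)
  have c_sum: "1 / c = \<iota> + \<kappa>" using q by (simp add: \<iota>_def \<kappa>_def)
  have p_sum: "p * (\<iota> + \<beta>) = 1" using q p by (simp add: \<iota>_def \<beta>_def field_simps)
  define D where "D = 1 / (1 - \<iota>) + 1 / \<iota>"
  have D: "0 < D" unfolding D_def using \<iota> by (intro add_pos_pos) auto
  define a where "a w = Bergman_size z w * Bergman_weight w powr \<kappa> * norm (f w) powr p" for w
  define d where "d w = Bergman_size z w * Bergman_weight w powr (- \<iota>)" for w
  have rz: "0 < Bergman_weight z" using z by (rule Bergman_weight_pos)
  have [measurable]: "a \<in> borel_measurable disc_area" "d \<in> borel_measurable disc_area"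
    unfolding a_def d_def by measurable
  have J: "?J = (\<integral>\<^sup>+w. ennreal (a w) \<partial>disc_area)" by (simp add: a_def)
  show ?thesis
  proof (cases "?J = 0")
    case True
    then have "AE w in disc_area. a w \<le> 0"
      unfolding J by (subst (asm) nn_integral_0_iff_AE) (auto simp: ennreal_eq_0_iff)
    then have "AE w in disc_area. f w = 0"
    proof (rule AE_mp, intro AE_I2 impI)
      fix w assume w: "w \<in> space disc_area" and "a w \<le> 0"
      have "0 < Bergman_size z w * Bergman_weight w powr \<kappa>"
        using w z Bergman_size_pos[of z w] Bergman_weight_pos[of w] by simp
      note pos = this
      show "f w = 0"
      proof (rule ccontr)
        assume "f w \<noteq> 0"
        then have "0 < Bergman_size z w * Bergman_weight w powr \<kappa> * norm (f w) powr p"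
          by (intro mult_pos_pos[OF pos]) auto
        then show False using \<open>a w \<le> 0\<close> unfolding a_def by linarith
      qed
    qed
    then have "T_op \<nu> f z = 0"
      unfolding T_op_eq_T_kernel by (intro integral_eq_zero_AE) auto
    then show ?thesis by simp
  next
    case J0: False
    obtain j where j: "?J = ennreal j" "0 < j"
      using J0 False by (cases ?J) (auto simp: less_le)
    have aj: "(\<integral>\<^sup>+w. ennreal (a w) \<partial>disc_area) \<le> ennreal j"
      unfolding J[symmetric] j(1) by (rule order_refl)
    have nonneg: "0 \<le> a w" "0 \<le> d w" for w
      by (simp_all add: a_def d_def Bergman_size_nonneg)
    have H: "(\<integral>\<^sup>+w. ennreal (a w powr \<iota> * (norm (f w) powr p) powr \<beta> * d w powr \<kappa>) \<partial>disc_area)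
      \<le> ennreal (j powr \<iota> * I powr \<beta> * (D * Bergman_weight z powr (- \<iota>)) powr \<kappa>)"
    proof (rule nn_integral_Hoelder3)
      show "(\<integral>\<^sup>+w. ennreal (d w) \<partial>disc_area) \<le> ennreal (D * Bergman_weight z powr (- \<iota>))"
        unfolding d_def D_def by (rule Bergman_size_integral_bound) (use \<iota> z in auto)
    qed (use \<iota> \<kappa> \<beta> sum1 aj j(2) I D rz nonneg in auto)
    have pw: "norm (T_kernel \<nu> z w * f w) \<le> B * (a w powr \<iota> * (norm (f w) powr p) powr \<beta> * d w powr \<kappa>)"
      if "w \<in> space disc_area" for w
    proof -
      from that have w: "norm w < 1" by simp
      have P: "0 < Bergman_size z w" and R: "0 < Bergman_weight w"
        using w z Bergman_size_pos Bergman_weight_pos by auto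
      have n: "0 < norm (1 - z * cnj w)" using one_minus_mult_cnj_nonzero[OF z w] by simp
      have "norm (1 - z * cnj w) powr (- 2 / c) = Bergman_size z w powr (1 / c)"
        using n unfolding Bergman_size_def powr_minus_divide
        by (simp add: powr_divide powr_powr powr_minus_divide flip: powr_numeral)
      also have "\<dots> = Bergman_size z w powr \<iota> * Bergman_size z w powr \<kappa>"
        by (simp add: c_sum powr_add)
      finally have n2: "norm (1 - z * cnj w) powr (- 2 / c) = Bergman_size z w powr \<iota> * Bergman_size z w powr \<kappa>" .
      have R1: "(Bergman_weight w powr \<kappa>) powr \<iota> * (Bergman_weight w powr (- \<iota>)) powr \<kappa> = 1"
        using R by (simp add: powr_powr powr_add[symmetric] mult.commute)
      have F1: "(norm (f w) powr p) powr \<iota> * (norm (f w) powr p) powr \<beta> = norm (f w)"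
        using p_sum by (cases "f w = 0") (simp_all add: powr_powr powr_add[symmetric] distrib_left[symmetric])
      have "a w powr \<iota> * (norm (f w) powr p) powr \<beta> * d w powr \<kappa>
        = (Bergman_size z w powr \<iota> * Bergman_size z w powr \<kappa>)
          * ((Bergman_weight w powr \<kappa>) powr \<iota> * (Bergman_weight w powr (- \<iota>)) powr \<kappa>)
          * ((norm (f w) powr p) powr \<iota> * (norm (f w) powr p) powr \<beta>)"
        by (simp add: a_def d_def powr_mult P less_imp_le mult_ac)
      also have "\<dots> = norm (1 - z * cnj w) powr (- 2 / c) * norm (f w)"
        unfolding R1 F1 n2 by simp
      finally show ?thesis
        using mult_right_mono[OF K[OF w], of "norm (f w)"] by (simp add: norm_mult mult.assoc)
    qed
    have "ennreal (norm (T_op \<nu> f z)) \<le> (\<integral>\<^sup>+w. ennreal (norm (T_kernel \<nu> z w * f w)) \<partial>disc_area)"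
      unfolding T_op_eq_T_kernel by (rule norm_integral_le_nn_integral)
    also have "\<dots> \<le> (\<integral>\<^sup>+w. ennreal B * ennreal (a w powr \<iota> * (norm (f w) powr p) powr \<beta> * d w powr \<kappa>) \<partial>disc_area)"
      using pw B by (intro nn_integral_mono) (simp add: ennreal_mult[symmetric] ennreal_leI)
    also have "\<dots> = ennreal B * (\<integral>\<^sup>+w. ennreal (a w powr \<iota> * (norm (f w) powr p) powr \<beta> * d w powr \<kappa>) \<partial>disc_area)"
      by (rule nn_integral_cmult) measurable
    also have "\<dots> \<le> ennreal B * ennreal (j powr \<iota> * I powr \<beta> * (D * Bergman_weight z powr (- \<iota>)) powr \<kappa>)"
      by (intro mult_left_mono H) auto
    also have "\<dots> = ennreal (B * (j powr \<iota> * I powr \<beta> * (D * Bergman_weight z powr (- \<iota>)) powr \<kappa>))"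
      using B by (simp add: ennreal_mult)
    finally have "norm (T_op \<nu> f z) \<le> B * (j powr \<iota> * I powr \<beta> * (D * Bergman_weight z powr (- \<iota>)) powr \<kappa>)"
      using B by (subst (asm) ennreal_le_iff) auto
    then have "norm (T_op \<nu> f z) powr q \<le> (B * (j powr \<iota> * I powr \<beta> * (D * Bergman_weight z powr (- \<iota>)) powr \<kappa>)) powr q"
      using q by (intro powr_mono2) auto
    also have "\<dots> = (B * I powr \<beta> * D powr \<kappa>) powr q * (j powr \<iota>) powr q * ((Bergman_weight z powr (- \<iota>)) powr \<kappa>) powr q"
      using B D rz j by (simp add: powr_mult mult_ac)
    also have "(j powr \<iota>) powr q = j" using j(2) q(1) by (simp add: powr_powr \<iota>_def)
    also have "((Bergman_weight z powr (- \<iota>)) powr \<kappa>) powr q = Bergman_weight z powr (- \<kappa>)"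
      using q(1) by (simp add: powr_powr \<iota>_def)
    finally have "ennreal (norm (T_op \<nu> f z) powr q) \<le> ennreal ((B * I powr \<beta> * D powr \<kappa>) powr q * j * Bergman_weight z powr (- \<kappa>))"
      by (rule ennreal_leI)
    also have "\<dots> = ennreal ((B * I powr \<beta> * D powr \<kappa>) powr q * Bergman_weight z powr (- \<kappa>)) * ennreal j"
      using j by (subst ennreal_mult[symmetric]) (auto simp: mult_ac)
    finally show ?thesis unfolding D_def j .
  qed
qed

text \<open>
  The other half: integrate the pointwise bound over $z$, exchange the integrals, and apply the
  Forelli--Rudin estimate in the variable $z$ with exponent $\kappa = 1-\frac1p$.
\<close>
lemma (in unit_interval_measure) T_op_nn_integral_bound:
  fixes p q c B I :: real and f :: "complex \<Rightarrow> complex"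
  assumes p: "1 < p" and c: "1 \<le> c" and q: "0 < q" "1 / q = 1 / p + 1 / c - 1" and B: "0 \<le> B"
    and K: "\<And>z w. norm z < 1 \<Longrightarrow> norm w < 1 \<Longrightarrow> norm (T_kernel \<nu> z w) \<le> B * norm (1 - z * cnj w) powr (- 2 / c)"
    and f[measurable]: "f \<in> borel_measurable disc_area"
    and I: "(\<integral>\<^sup>+w. ennreal (norm (f w) powr p) \<partial>disc_area) = ennreal I" "0 < I"
  shows "(\<integral>\<^sup>+z. ennreal (norm (T_op \<nu> f z) powr q) \<partial>disc_area)
     \<le> ennreal ((B * (1 / (1 - 1 / q) + q) powr (1 - 1 / p)) powr q * (p + 1 / (1 - 1 / p)) * I powr (q / p))"
proof -
  define \<iota> \<kappa> \<beta> where "\<iota> = 1 / q" and "\<kappa> = 1 - 1 / p" and "\<beta> = 1 - 1 / c"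
  define D where "D = 1 / (1 - \<iota>) + 1 / \<iota>"
  define C where "C = (B * I powr \<beta> * D powr \<kappa>) powr q"
  define E where "E = 1 / (1 - \<kappa>) + 1 / \<kappa>"
  have \<kappa>: "0 < \<kappa>" "\<kappa> < 1" using p by (auto simp: \<kappa>_def)
  have "1 / p < 1" "1 / c \<le> 1" using p c by auto
  then have "1 / q < 1" using q(2) by linarith
  then have \<iota>: "0 < \<iota>" "\<iota> < 1" using q(1) by (auto simp: \<iota>_def)
  have D: "0 < D" unfolding D_def using \<iota> by (intro add_pos_pos) auto
  have E: "0 < E" unfolding E_def using \<kappa> by (intro add_pos_pos) auto
  have C: "0 \<le> C" by (simp add: C_def)
  interpret P: pair_sigma_finite disc_area disc_area ..
  have "(\<integral>\<^sup>+z. ennreal (norm (T_op \<nu> f z) powr q) \<partial>disc_area)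
    \<le> (\<integral>\<^sup>+z. ennreal (C * Bergman_weight z powr (- \<kappa>))
      * (\<integral>\<^sup>+w. ennreal (Bergman_size z w * Bergman_weight w powr \<kappa> * norm (f w) powr p) \<partial>disc_area) \<partial>disc_area)"
    unfolding C_def D_def \<iota>_def \<kappa>_def \<beta>_def
    by (intro nn_integral_mono T_op_pointwise_bound assms) (use I in auto)
  also have "\<dots> = (\<integral>\<^sup>+z. (\<integral>\<^sup>+w. ennreal (C * Bergman_weight z powr (- \<kappa>)) *
       ennreal (Bergman_size z w * Bergman_weight w powr \<kappa> * norm (f w) powr p) \<partial>disc_area) \<partial>disc_area)"
    by (intro nn_integral_cong nn_integral_cmult[symmetric]) measurable
  also have "\<dots> = (\<integral>\<^sup>+w. (\<integral>\<^sup>+z. ennreal (C * Bergman_weight z powr (- \<kappa>)) *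
       ennreal (Bergman_size z w * Bergman_weight w powr \<kappa> * norm (f w) powr p) \<partial>disc_area) \<partial>disc_area)"
    by (rule P.Fubini') measurable
  also have "\<dots> = (\<integral>\<^sup>+w. ennreal (C * Bergman_weight w powr \<kappa> * norm (f w) powr p) *
      (\<integral>\<^sup>+z. ennreal (Bergman_size z w * Bergman_weight z powr (- \<kappa>)) \<partial>disc_area) \<partial>disc_area)"
  proof (rule nn_integral_cong)
    fix w
    have "ennreal (C * Bergman_weight z powr (- \<kappa>)) * ennreal (Bergman_size z w * Bergman_weight w powr \<kappa> * norm (f w) powr p)
      = ennreal (C * Bergman_weight w powr \<kappa> * norm (f w) powr p) * ennreal (Bergman_size z w * Bergman_weight z powr (- \<kappa>))" for z
      using C by (simp add: ennreal_mult[symmetric] Bergman_size_nonneg mult_ac)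
    then show "(\<integral>\<^sup>+z. ennreal (C * Bergman_weight z powr (- \<kappa>)) *
       ennreal (Bergman_size z w * Bergman_weight w powr \<kappa> * norm (f w) powr p) \<partial>disc_area)
      = ennreal (C * Bergman_weight w powr \<kappa> * norm (f w) powr p) *
      (\<integral>\<^sup>+z. ennreal (Bergman_size z w * Bergman_weight z powr (- \<kappa>)) \<partial>disc_area)"
      by (simp add: nn_integral_cmult)
  qed
  also have "\<dots> \<le> (\<integral>\<^sup>+w. ennreal (C * E) * ennreal (norm (f w) powr p) \<partial>disc_area)"
  proof (rule nn_integral_mono)
    fix w assume "w \<in> space disc_area"
    then have w: "norm w < 1" by simp
    have R: "0 < Bergman_weight w" using w by (rule Bergman_weight_pos)
    have "ennreal (C * Bergman_weight w powr \<kappa> * norm (f w) powr p) *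
      (\<integral>\<^sup>+z. ennreal (Bergman_size z w * Bergman_weight z powr (- \<kappa>)) \<partial>disc_area)
      \<le> ennreal (C * Bergman_weight w powr \<kappa> * norm (f w) powr p) * ennreal (E * Bergman_weight w powr (- \<kappa>))"
      unfolding E_def by (intro mult_left_mono Bergman_size_integral_bound' \<kappa> w) simp
    also have "\<dots> = ennreal (C * E * norm (f w) powr p)"
      using C E R by (simp add: ennreal_mult[symmetric] powr_minus field_simps)
    also have "\<dots> = ennreal (C * E) * ennreal (norm (f w) powr p)"
      using C E by (intro ennreal_mult) auto
    finally show "ennreal (C * Bergman_weight w powr \<kappa> * norm (f w) powr p) *
      (\<integral>\<^sup>+z. ennreal (Bergman_size z w * Bergman_weight z powr (- \<kappa>)) \<partial>disc_area)
      \<le> ennreal (C * E) * ennreal (norm (f w) powr p)" .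
  qed
  also have "\<dots> = ennreal (C * E * I)"
    using C E I by (subst nn_integral_cmult) (simp_all add: ennreal_mult[symmetric])
  also have "C * E * I = (B * D powr \<kappa>) powr q * E * I powr (q / p)"
  proof -
    have "q / p = \<beta> * q + 1" using q p c by (simp add: \<beta>_def field_simps)
    then have "I powr (q / p) = (I powr \<beta>) powr q * I"
      using I by (simp add: powr_powr powr_add)
    then show ?thesis using B D I by (simp add: C_def powr_mult mult_ac)
  qed
  finally show ?thesis unfolding D_def E_def \<iota>_def \<kappa>_def by (simp add: add.commute)
qed

lemma Lp_disc_nn_integral:
  assumes "f \<in> Lp_disc p"
  shows "(\<integral>\<^sup>+w. ennreal (norm (f w) powr p) \<partial>disc_area) = ennreal (LINT w|disc_area. norm (f w) powr p)"
  using assms by (intro nn_integral_eq_integral) (auto simp: Lp_disc_def)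

theorem (in unit_interval_measure) bounded_Lp_Lq_of_kernel_bound:
  fixes p q c B :: real
  assumes p: "1 < p" and c: "1 \<le> c" and q: "0 < q" "1 / q = 1 / p + 1 / c - 1" and B: "0 \<le> B"
    and K: "\<And>z w. norm z < 1 \<Longrightarrow> norm w < 1 \<Longrightarrow> norm (T_kernel \<nu> z w) \<le> B * norm (1 - z * cnj w) powr (- 2 / c)"
  shows "bounded_Lp_Lq (T_op \<nu>) p q"
proof -
  define C where "C = (B * (1 / (1 - 1 / q) + q) powr (1 - 1 / p)) powr q * (p + 1 / (1 - 1 / p))"
  have C: "0 \<le> C" using p by (simp add: C_def)
  have "T_op \<nu> f \<in> Lp_disc q \<and> Lp_norm q (T_op \<nu> f) \<le> C powr (1 / q) * Lp_norm p f" if f: "f \<in> Lp_disc p" for f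
  proof -
    define I where "I = (LINT w|disc_area. norm (f w) powr p)"
    have fm[measurable]: "f \<in> borel_measurable disc_area" using f by (simp add: Lp_disc_def)
    have I: "(\<integral>\<^sup>+w. ennreal (norm (f w) powr p) \<partial>disc_area) = ennreal I"
      unfolding I_def using f by (rule Lp_disc_nn_integral)
    have I0: "0 \<le> I" by (simp add: I_def)
    have Tm[measurable]: "T_op \<nu> f \<in> borel_measurable disc_area" by (rule T_op_measurable) simp
    have bd: "(\<integral>\<^sup>+z. ennreal (norm (T_op \<nu> f z) powr q) \<partial>disc_area) \<le> ennreal (C * I powr (q / p))"
    proof (cases "I = 0")
      case True
      then have "(\<integral>\<^sup>+w. ennreal (norm (f w) powr p) \<partial>disc_area) = 0" using I by simp
      then have "AE w in disc_area. norm (f w) powr p \<le> 0"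
        by (subst (asm) nn_integral_0_iff_AE) auto
      then have "AE w in disc_area. f w = 0"
        by eventually_elim (simp add: not_less[symmetric])
      then have "T_op \<nu> f z = 0" for z
        unfolding T_op_eq_T_kernel by (intro integral_eq_zero_AE) auto
      then show ?thesis by simp
    next
      case False
      with I0 have "0 < I" by simp
      from T_op_nn_integral_bound[OF p c q B K fm I this]
      show ?thesis by (simp add: C_def)
    qed
    have int: "integrable disc_area (\<lambda>z. norm (T_op \<nu> f z) powr q)"
      using bd by (intro integrableI_bounded) (auto intro: le_less_trans)
    then have "ennreal (LINT z|disc_area. norm (T_op \<nu> f z) powr q) \<le> ennreal (C * I powr (q / p))"
      using bd by (subst (asm) nn_integral_eq_integral) auto
    then have "(LINT z|disc_area. norm (T_op \<nu> f z) powr q) \<le> C * I powr (q / p)"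
      using C by (subst (asm) ennreal_le_iff) auto
    then have "Lp_norm q (T_op \<nu> f) \<le> (C * I powr (q / p)) powr (1 / q)"
      unfolding Lp_norm_def using q(1) by (intro powr_mono2) auto
    also have "\<dots> = C powr (1 / q) * Lp_norm p f"
      using C q(1) by (simp add: powr_mult powr_powr Lp_norm_def I_def)
    finally show ?thesis using int by (simp add: Lp_disc_def)
  qed
  then show ?thesis unfolding bounded_Lp_Lq_def by blast
qed

section \<open>The growth of the Stieltjes transform\<close>

text \<open>The Stieltjes transform of the image of $\nu$ under $r \mapsto 1-r$; only $t > 0$ is of interest.\<close>

definition Stieltjes :: "real measure \<Rightarrow> real \<Rightarrow> real" where
  "Stieltjes \<nu> t = (LINT r|\<nu>. 1 / (1 - r + t))"

text \<open>
  The growth condition $N(t) = O(t^{1-2/c})$ on $(0,1]$, to which weak and strong boundedness are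
  both equivalent.
\<close>
definition Stieltjes_growth :: "real \<Rightarrow> real measure \<Rightarrow> bool" where
  "Stieltjes_growth c \<nu> \<longleftrightarrow> (\<exists>B. \<forall>t\<in>{0<..1}. Stieltjes \<nu> t \<le> B * t powr (1 - 2 / c))"

context unit_interval_measure
begin

lemma Stieltjes_integrable:
  assumes "0 < t" shows "integrable \<nu> (\<lambda>r. 1 / (1 - r + t))"
proof (rule integrable_const_bound[where B="1 / t"])
  show "AE r in \<nu>. norm (1 / (1 - r + t)) \<le> 1 / t"
    using assms by (intro AE_I2) (auto simp: space_nu intro!: divide_left_mono)
qed measurable

lemma Stieltjes_nonneg: "0 < t \<Longrightarrow> 0 \<le> Stieltjes \<nu> t"
  unfolding Stieltjes_def by (intro Bochner_Integration.integral_nonneg_AE AE_I2) (auto simp: space_nu)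

lemma ennreal_Stieltjes:
  assumes "0 < t" shows "ennreal (Stieltjes \<nu> t) = (\<integral>\<^sup>+r. ennreal (1 / (1 - r + t)) \<partial>\<nu>)"
  unfolding Stieltjes_def using assms
  by (intro nn_integral_eq_integral[symmetric] Stieltjes_integrable AE_I2) (auto simp: space_nu)

lemma norm_one_minus_real_mult_ge:
  fixes \<zeta> :: complex
  assumes "norm \<zeta> \<le> 1" "0 \<le> r" "r \<le> 1"
  shows "(1 - r + norm (1 - \<zeta>)) / 3 \<le> norm (1 - of_real r * \<zeta>)"
proof -
  have "r * norm \<zeta> \<le> r * 1" using assms by (intro mult_left_mono) auto
  moreover have "1 - norm (of_real r * \<zeta>) \<le> norm (1 - of_real r * \<zeta>)"
    using norm_triangle_ineq2[of 1 "of_real r * \<zeta>"] by simp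
  ultimately have 1: "1 - r \<le> norm (1 - of_real r * \<zeta>)"
    using assms by (simp add: norm_mult)
  have "norm (of_real (1 - r) * \<zeta>) = (1 - r) * norm \<zeta>" using assms by (simp add: norm_mult norm_of_real del: of_real_diff)
  also have "\<dots> \<le> (1 - r) * 1" using assms by (intro mult_left_mono) auto
  finally have 2: "norm (of_real (1 - r) * \<zeta>) \<le> 1 - r" by simp
  have "1 - \<zeta> = (1 - of_real r * \<zeta>) - of_real (1 - r) * \<zeta>"
    by (simp add: algebra_simps)
  then have "norm (1 - \<zeta>) \<le> norm (1 - of_real r * \<zeta>) + norm (of_real (1 - r) * \<zeta>)"
    using norm_triangle_ineq4 by metis
  with 1 2 show ?thesis by simp
qed

lemma integrable_Cauchy_factor:
  fixes \<zeta> :: complex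
  assumes \<zeta>: "norm \<zeta> < 1"
  shows "integrable \<nu> (\<lambda>r. 1 / (1 - of_real r * \<zeta>))"
    and "norm (LINT r|\<nu>. 1 / (1 - of_real r * \<zeta>)) \<le> measure \<nu> (space \<nu>) / (1 - norm \<zeta>)"
proof -
  have le: "norm (1 / (1 - of_real r * \<zeta>)) \<le> 1 / (1 - norm \<zeta>)" if "r \<in> space \<nu>" for r
  proof -
    have "\<bar>r\<bar> * norm \<zeta> \<le> 1 * norm \<zeta>" using that by (intro mult_right_mono) (auto simp: space_nu)
    then have "1 - norm \<zeta> \<le> norm (1 - of_real r * \<zeta>)"
      using norm_triangle_ineq2[of 1 "of_real r * \<zeta>"] by (simp add: norm_mult)
    then show ?thesis using \<zeta> by (simp add: norm_divide) (intro divide_left_mono mult_pos_pos, auto)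
  qed
  show i: "integrable \<nu> (\<lambda>r. 1 / (1 - of_real r * \<zeta>))"
    by (rule integrable_const_bound[where B="1 / (1 - norm \<zeta>)"]) (use le in auto)
  have "norm (LINT r|\<nu>. 1 / (1 - of_real r * \<zeta>)) \<le> (LINT r|\<nu>. 1 / (1 - norm \<zeta>))"
    by (rule Bochner_Integration.integral_norm_bound_integral[OF i _ le]) auto
  then show "norm (LINT r|\<nu>. 1 / (1 - of_real r * \<zeta>)) \<le> measure \<nu> (space \<nu>) / (1 - norm \<zeta>)" by simp
qed

text \<open>
  The Stieltjes transform is taken at $\delta/2$ with $\delta = |1-z\overline w| < 2$ because growth is
  assumed on $(0,1]$ only.
\<close>
lemma T_kernel_bound:
  assumes c: "1 \<le> c" and B: "\<And>t. 0 < t \<Longrightarrow> t \<le> 1 \<Longrightarrow> Stieltjes \<nu> t \<le> B * t powr (1 - 2 / c)"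
    and z: "norm z < 1" and w: "norm w < 1"
  shows "norm (T_kernel \<nu> z w) \<le> (6 * B) * norm (1 - z * cnj w) powr (- 2 / c)"
proof -
  define \<zeta> where "\<zeta> = z * cnj w"
  define \<delta> where "\<delta> = norm (1 - \<zeta>)"
  have \<zeta>: "norm \<zeta> < 1" unfolding \<zeta>_def by (rule norm_mult_cnj_less_1[OF z w])
  have "1 - \<zeta> \<noteq> 0" using \<zeta> by auto
  then have \<delta>0: "0 < \<delta>" by (simp add: \<delta>_def)
  have \<delta>2: "\<delta> \<le> 2" using norm_triangle_ineq4[of 1 \<zeta>] \<zeta> by (simp add: \<delta>_def)
  have B0: "0 \<le> B" using B[of 1] Stieltjes_nonneg[of 1] by simp
  have "norm (LINT r|\<nu>. 1 / (1 - of_real r * \<zeta>)) \<le> (LINT r|\<nu>. 3 * (1 / (1 - r + \<delta> / 2)))"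
  proof (rule Bochner_Integration.integral_norm_bound_integral)
    show "integrable \<nu> (\<lambda>r. 3 * (1 / (1 - r + \<delta> / 2)))"
      using \<delta>0 by (intro integrable_mult_right Stieltjes_integrable) simp
    show "norm (1 / (1 - of_real r * \<zeta>)) \<le> 3 * (1 / (1 - r + \<delta> / 2))" if "r \<in> space \<nu>" for r
    proof -
      have r: "0 \<le> r" "r \<le> 1" using that by (auto simp: space_nu)
      have "(1 - r + \<delta> / 2) / 3 \<le> (1 - r + \<delta>) / 3" using \<delta>0 by simp
      also have "\<dots> \<le> norm (1 - of_real r * \<zeta>)"
        unfolding \<delta>_def by (rule norm_one_minus_real_mult_ge) (use r \<zeta> in auto)
      finally have "1 / norm (1 - of_real r * \<zeta>) \<le> 1 / ((1 - r + \<delta> / 2) / 3)"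
        using r \<delta>0 by (intro divide_left_mono mult_pos_pos) auto
      then show ?thesis by (simp add: norm_divide)
    qed
    show "integrable \<nu> (\<lambda>r. 1 / (1 - of_real r * \<zeta>))"
      by (rule integrable_Cauchy_factor(1)[OF \<zeta>])
  qed
  also have "\<dots> = 3 * Stieltjes \<nu> (\<delta> / 2)"
    by (subst integral_mult_right_zero) (simp add: Stieltjes_def)
  also have "\<dots> \<le> 3 * (B * (\<delta> / 2) powr (1 - 2 / c))"
    using \<delta>0 \<delta>2 by (intro mult_left_mono B) auto
  also have "(\<delta> / 2) powr (1 - 2 / c) = \<delta> powr (1 - 2 / c) * 2 powr (2 / c - 1)"
    using \<delta>0 by (simp add: powr_divide powr_diff field_simps)
  also have "3 * (B * (\<delta> powr (1 - 2 / c) * 2 powr (2 / c - 1))) \<le> 3 * (B * (\<delta> powr (1 - 2 / c) * 2 powr 1))"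
    using c B0 by (intro mult_left_mono powr_mono) (auto simp: field_simps)
  finally have "norm (LINT r|\<nu>. 1 / (1 - of_real r * \<zeta>)) \<le> 6 * B * \<delta> powr (1 - 2 / c)" by simp
  then have "norm (T_kernel \<nu> z w) \<le> 1 / \<delta> * (6 * B * \<delta> powr (1 - 2 / c))"
    unfolding T_kernel_def \<delta>_def \<zeta>_def norm_mult norm_divide norm_one mult.assoc
    using \<delta>0 by (intro mult_left_mono) auto
  also have "\<dots> = 6 * B * \<delta> powr (- 2 / c)"
    using \<delta>0 by (simp add: powr_diff powr_minus field_simps)
  finally show ?thesis by (simp add: \<delta>_def \<zeta>_def)
qed

text \<open>
  If $u$ and $v$ are within ten per cent of positive numbers, then $uv$ stays in a sector around
  the positive axis.
\<close>
lemma Re_inverse_mult_ge: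
  fixes u v :: complex and X Y :: real
  assumes X: "0 < X" "norm (u - of_real X) \<le> X / 10" and Y: "0 < Y" "norm (v - of_real Y) \<le> Y / 10"
  shows "1 / (2 * X * Y) \<le> Re (1 / (u * v))"
proof -
  define e g where "e = (u - of_real X) / of_real X" and "g = (v - of_real Y) / of_real Y"
  have e: "norm e \<le> 1 / 10" and g: "norm g \<le> 1 / 10"
    using X Y by (auto simp: e_def g_def norm_divide field_simps)
  define s where "s = (1 + e) * (1 + g)"
  have u: "u = of_real X * (1 + e)" and v: "v = of_real Y * (1 + g)"
    using X Y by (auto simp: e_def g_def field_simps)
  have "norm e * norm g \<le> 1 / 10 * (1 / 10)" using e g by (intro mult_mono) auto
  moreover have "s - 1 = e + g + e * g" by (simp add: s_def algebra_simps)
  then have "norm (s - 1) \<le> norm e + norm g + norm e * norm g"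
    using norm_triangle_ineq[of "e + g" "e * g"] norm_triangle_ineq[of e g] by (simp add: norm_mult)
  ultimately have s1: "norm (s - 1) \<le> 21 / 100" using e g by simp
  have "\<bar>Re (s - 1)\<bar> \<le> 21 / 100" using abs_Re_le_cmod[of "s - 1"] s1 by linarith
  moreover have "Re (s - 1) = Re s - 1" by simp
  ultimately have Re: "79 / 100 \<le> Re s" by linarith
  have "norm s \<le> 121 / 100" using norm_triangle_ineq[of "s - 1" 1] s1 by simp
  then have "(norm s)\<^sup>2 \<le> (121 / 100)\<^sup>2" by (intro power_mono) auto
  then have ns: "(norm s)\<^sup>2 \<le> 2 * (79 / 100)" by (simp add: power2_eq_square)
  have s0: "0 < (norm s)\<^sup>2" using Re by auto
  have "1 / 2 * (norm s)\<^sup>2 \<le> Re s" using ns Re by simp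
  then have "1 / 2 \<le> Re s / (norm s)\<^sup>2" using s0 by (subst pos_le_divide_eq) auto
  also have "\<dots> = Re (1 / s)" by (simp add: Re_divide cmod_power2)
  finally have "1 / 2 \<le> Re (1 / s)" .
  moreover have "1 / (u * v) = (1 / s) / of_real (X * Y)" by (simp add: u v s_def)
  ultimately show ?thesis using X Y by (simp only: Re_divide_of_real) (simp add: field_simps)
qed

text \<open>The kernel does not oscillate on a disc that is small compared with its distance from the circle.\<close>

lemma Re_T_kernel_ge:
  assumes t: "0 < t" "t \<le> 1"
    and z: "z \<in> ball (of_real (1 - t)) (t / 20)" and w: "w \<in> ball (of_real (1 - t)) (t / 20)"
  shows "Stieltjes \<nu> t / (8 * t) \<le> Re (T_kernel \<nu> z w)"
proof -
  define a where "a = 1 - t"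
  define \<zeta> where "\<zeta> = z * cnj w"
  have a: "0 \<le> a" "a \<le> 1" using t by (auto simp: a_def)
  have za: "norm (z - of_real a) < t / 20" and wa: "norm (w - of_real a) < t / 20"
    using z w by (auto simp: a_def dist_norm norm_minus_commute simp del: of_real_diff)
  have inD: "norm x < 1" if "norm (x - of_real a) < t / 20" for x :: complex
    using norm_triangle_ineq2[of x "of_real a"] that t by (simp add: a_def norm_of_real del: of_real_diff)
  have zw: "norm z < 1" "norm w < 1" using za wa by (auto intro: inD)
  have \<zeta>: "norm \<zeta> < 1" unfolding \<zeta>_def by (rule norm_mult_cnj_less_1[OF zw])
  have "norm (\<zeta> - of_real (a\<^sup>2)) \<le> t / 10"
  proof -
    have "\<zeta> - of_real (a\<^sup>2) = (z - of_real a) * cnj w + of_real a * cnj (w - of_real a)"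
      by (simp add: \<zeta>_def algebra_simps power2_eq_square)
    then have "norm (\<zeta> - of_real (a\<^sup>2)) \<le> norm ((z - of_real a) * cnj w) + norm (of_real a * cnj (w - of_real a))"
      using norm_triangle_ineq by metis
    also have "\<dots> = norm (z - of_real a) * norm w + a * norm (w - of_real a)"
      using a by (simp only: norm_mult complex_mod_cnj norm_of_real abs_of_nonneg)
    also have "\<dots> \<le> (t / 20) * 1 + 1 * (t / 20)"
      using za wa zw a t by (intro add_mono mult_mono) auto
    finally show ?thesis by simp
  qed
  note near = this
  have pw: "1 / (8 * t) * (1 / (1 - r + t)) \<le> Re (1 / (1 - \<zeta>) * (1 / (1 - of_real r * \<zeta>)))" if "r \<in> space \<nu>" for r
  proof -
    have r: "0 \<le> r" "r \<le> 1" using that by (auto simp: space_nu)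
    define X Y where "X = 1 - a\<^sup>2" and "Y = 1 - r * a\<^sup>2"
    have X: "t \<le> X" "X \<le> 2 * t" using t by (auto simp: X_def a_def power2_eq_square algebra_simps mult_left_le)
    have "r * a\<^sup>2 \<le> 1 * a\<^sup>2" using r by (intro mult_right_mono) auto
    then have Y1: "t \<le> Y" using X by (simp add: Y_def X_def)
    have "Y = (1 - r) + r * X" by (simp add: X_def Y_def algebra_simps)
    also have "\<dots> \<le> (1 - r) + 1 * (2 * t)" using X r t by (intro add_left_mono mult_mono) auto
    also have "\<dots> \<le> 2 * (1 - r + t)" using r by simp
    finally have Y2: "Y \<le> 2 * (1 - r + t)" .
    have "norm ((1 - \<zeta>) - of_real X) \<le> X / 10"
    proof -
      have "(1 - \<zeta>) - of_real X = - (\<zeta> - of_real (a\<^sup>2))" by (simp add: X_def)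
      then show ?thesis using near X by (simp only: norm_minus_cancel)
    qed
    moreover have "norm ((1 - of_real r * \<zeta>) - of_real Y) \<le> Y / 10"
    proof -
      have "(1 - of_real r * \<zeta>) - of_real Y = - (of_real r * (\<zeta> - of_real (a\<^sup>2)))" by (simp add: Y_def algebra_simps)
      then have "norm ((1 - of_real r * \<zeta>) - of_real Y) = r * norm (\<zeta> - of_real (a\<^sup>2))"
        using r by (simp only: norm_minus_cancel norm_mult norm_of_real abs_of_nonneg)
      also have "\<dots> \<le> 1 * (t / 10)" using near r t by (intro mult_mono) auto
      finally show ?thesis using Y1 by simp
    qed
    ultimately have "1 / (2 * X * Y) \<le> Re (1 / ((1 - \<zeta>) * (1 - of_real r * \<zeta>)))"
      using X Y1 t by (intro Re_inverse_mult_ge) auto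
    moreover have "2 * X * Y \<le> 2 * (2 * t) * (2 * (1 - r + t))"
      using X Y1 Y2 t by (intro mult_mono) auto
    then have "1 / (2 * (2 * t) * (2 * (1 - r + t))) \<le> 1 / (2 * X * Y)"
      using X Y1 t r by (intro divide_left_mono mult_pos_pos) auto
    ultimately show ?thesis by (simp add: mult_ac)
  qed
  have i: "integrable \<nu> (\<lambda>r. 1 / (1 - \<zeta>) * (1 / (1 - of_real r * \<zeta>)))"
    by (intro integrable_mult_right integrable_Cauchy_factor \<zeta>)
  have "Stieltjes \<nu> t / (8 * t) = (LINT r|\<nu>. 1 / (8 * t) * (1 / (1 - r + t)))"
    by (subst integral_mult_right_zero) (simp add: Stieltjes_def)
  also have "\<dots> \<le> (LINT r|\<nu>. Re (1 / (1 - \<zeta>) * (1 / (1 - of_real r * \<zeta>))))"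
    using t by (intro integral_mono pw integrable_Re i integrable_mult_right Stieltjes_integrable) auto
  also have "\<dots> = Re (LINT r|\<nu>. 1 / (1 - \<zeta>) * (1 / (1 - of_real r * \<zeta>)))"
    using i by (rule integral_Re)
  also have "(LINT r|\<nu>. 1 / (1 - \<zeta>) * (1 / (1 - of_real r * \<zeta>))) = T_kernel \<nu> z w"
    by (subst integral_mult_right_zero) (simp add: T_kernel_def \<zeta>_def mult.assoc)
  finally show ?thesis .
qed

lemma T_kernel_section_integrable:
  assumes z: "norm z < 1" and f: "integrable disc_area f"
  shows "integrable disc_area (\<lambda>w. T_kernel \<nu> z w * f w)"
proof (rule Bochner_Integration.integrable_bound)
  define M where "M = 1 / (1 - norm z) * (measure \<nu> (space \<nu>) / (1 - norm z))"
  show "integrable disc_area (\<lambda>w. of_real M * f w)" using f by simp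
  have [measurable]: "f \<in> borel_measurable disc_area" using f by auto
  have "(\<lambda>w. T_kernel \<nu> z w) \<in> borel_measurable disc_area"
    unfolding T_kernel_def by measurable
  then show "(\<lambda>w. T_kernel \<nu> z w * f w) \<in> borel_measurable disc_area" by measurable
  show "AE w in disc_area. norm (T_kernel \<nu> z w * f w) \<le> norm (of_real M * f w)"
  proof (intro AE_I2)
    fix w assume "w \<in> space disc_area"
    then have w: "norm w < 1" by simp
    have le: "norm (z * cnj w) \<le> norm z" using w mult_left_mono[of "norm w" 1 "norm z"] by (simp add: norm_mult)
    have "1 - norm z \<le> norm (1 - z * cnj w)"
      using norm_triangle_ineq2[of 1 "z * cnj w"] le by simp
    then have 1: "norm (1 / (1 - z * cnj w)) \<le> 1 / (1 - norm z)"
      using z by (simp add: norm_divide) (intro divide_left_mono mult_pos_pos, auto)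
    have "norm (LINT r|\<nu>. 1 / (1 - of_real r * (z * cnj w))) \<le> measure \<nu> (space \<nu>) / (1 - norm (z * cnj w))"
      by (rule integrable_Cauchy_factor(2)[OF norm_mult_cnj_less_1[OF z w]])
    also have "\<dots> \<le> measure \<nu> (space \<nu>) / (1 - norm z)"
      using le z by (intro divide_left_mono mult_pos_pos) auto
    finally have 2: "norm (LINT r|\<nu>. 1 / (1 - of_real r * (z * cnj w))) \<le> measure \<nu> (space \<nu>) / (1 - norm z)" .
    have "norm (T_kernel \<nu> z w) \<le> M"
      unfolding T_kernel_def M_def norm_mult[of "1 / _"] using 1 2 z
      by (intro mult_mono) (auto simp: mult.assoc)
    then show "norm (T_kernel \<nu> z w * f w) \<le> norm (of_real M * f w)"
      by (auto simp: norm_mult intro!: mult_right_mono)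
  qed
qed

section \<open>Growth is necessary and sufficient\<close>

text \<open>
  The test function is the indicator of the disc with centre $1-t$ and radius $t/20$. The level
  $\tau$ is half of the lower bound $\frac{N(t)}{8t}\cdot\frac{t^2}{400}$ for its image on that disc.
\<close>
theorem Stieltjes_growth_of_weak_type:
  assumes p: "1 < p" and c: "1 \<le> c" and q: "0 < q" "1 / q = 1 / p + 1 / c - 1"
    and weak: "bounded_Lp_weak_Lq (T_op \<nu>) p q"
  shows "Stieltjes_growth c \<nu>"
proof -
  from weak obtain C where C: "\<And>f. f \<in> Lp_disc p \<Longrightarrow> T_op \<nu> f \<in> weak_Lp_disc q \<and> weak_Lp_norm q (T_op \<nu> f) \<le> C * Lp_norm p f"
    unfolding bounded_Lp_weak_Lq_def by blast
  have "Stieltjes \<nu> t \<le> 6400 * (\<bar>C\<bar> + 1) * t powr (1 - 2 / c)" if t: "0 < t" "t \<le> 1" for t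
  proof (cases "Stieltjes \<nu> t = 0")
    case False
    define N where "N = Stieltjes \<nu> t"
    have N: "0 < N" using False Stieltjes_nonneg[OF t(1)] by (simp add: N_def)
    define E where "E = ball (complex_of_real (1 - t)) (t / 20)"
    define m where "m = (t / 20)\<^sup>2"
    have m: "0 < m" using t by (simp add: m_def)
    have E_sub: "E \<subseteq> ball 0 1"
      unfolding E_def using t by (subst ball_subset_ball_iff) (simp add: dist_norm norm_of_real del: of_real_diff)
    then have E[measurable]: "E \<in> sets disc_area" unfolding E_def by (rule ball_sets_disc_area)
    have E_meas: "measure disc_area E = m"
      unfolding E_def m_def by (rule measure_disc_area_ball) (use E_sub t in \<open>auto simp: E_def\<close>)
    define f :: "complex \<Rightarrow> complex" where "f = indicator E"
    have ind: "integrable disc_area (\<lambda>w. indicator E w :: real)"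
      by (rule integrable_real_indicator) (auto simp: less_top[symmetric])
    have f_pow: "norm (f w) powr p = indicator E w" for w
      by (simp add: f_def indicator_def)
    have f: "f \<in> Lp_disc p"
      using ind unfolding Lp_disc_def mem_Collect_eq f_pow by (simp add: f_def)
    have f_int: "integrable disc_area f"
    proof -
      have "f = (\<lambda>w. complex_of_real (indicator E w))" by (auto simp: f_def indicator_def)
      then show ?thesis using integrable_of_real[OF ind] by simp
    qed
    have f_norm: "Lp_norm p f = m powr (1 / p)"
      using E_sub by (simp add: Lp_norm_def f_pow E_meas Int_absorb2)
    define \<tau> where "\<tau> = t * N / 6400"
    have \<tau>: "0 < \<tau>" using t N by (simp add: \<tau>_def)
    have large: "\<tau> < norm (T_op \<nu> f z)" if z: "z \<in> E" for z
    proof -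
      have z1: "norm z < 1" using z E_sub by auto
      have i: "integrable disc_area (\<lambda>w. T_kernel \<nu> z w * f w)"
        by (rule T_kernel_section_integrable[OF z1 f_int])
      have "\<tau> < N / (8 * t) * m"
        using t N by (simp add: \<tau>_def m_def power2_eq_square field_simps)
      also have "\<dots> = (LINT w|disc_area. N / (8 * t) * indicator E w)"
        using E_sub by (simp add: E_meas Int_absorb2)
      also have "\<dots> \<le> (LINT w|disc_area. Re (T_kernel \<nu> z w * f w))"
      proof (rule integral_mono)
        show "integrable disc_area (\<lambda>w. N / (8 * t) * indicator E w)" using ind by simp
        show "integrable disc_area (\<lambda>w. Re (T_kernel \<nu> z w * f w))" using i by (rule integrable_Re)
        show "N / (8 * t) * indicator E w \<le> Re (T_kernel \<nu> z w * f w)" for w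
          using Re_T_kernel_ge[OF t, of z w] z by (auto simp: f_def N_def E_def indicator_def)
      qed
      also have "\<dots> = Re (T_op \<nu> f z)"
        unfolding T_op_eq_T_kernel using i by (rule integral_Re)
      also have "\<dots> \<le> norm (T_op \<nu> f z)" by (rule complex_Re_le_cmod)
      finally show ?thesis .
    qed
    \<comment> \<open>An infimum below $D$ gives an admissible constant below $D$; this needs $D$ strictly above $C\,\|f\|_p$.\<close>
    define D where "D = (\<bar>C\<bar> + 1) * m powr (1 / p)"
    have "C * m powr (1 / p) < D" using m by (simp add: D_def)
    with C[OF f] f_norm have "Inf (weak_bounds q (T_op \<nu> f)) < D" "weak_bounds q (T_op \<nu> f) \<noteq> {}"
      by (auto simp: weak_Lp_norm_def weak_Lp_disc_def)
    then obtain x where x: "x \<in> weak_bounds q (T_op \<nu> f)" "x < D"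
      using cInf_lessD by blast
    have Tm[measurable]: "T_op \<nu> f \<in> borel_measurable disc_area"
      using f by (intro T_op_measurable) (simp add: Lp_disc_def)
    have "m \<le> measure disc_area {z \<in> ball 0 1. \<tau> < norm (T_op \<nu> f z)}"
      unfolding E_meas[symmetric]
    proof (rule disc_area.finite_measure_mono)
      show "E \<subseteq> {z \<in> ball 0 1. \<tau> < norm (T_op \<nu> f z)}" using large E_sub by auto
      have "{z \<in> space disc_area. \<tau> < norm (T_op \<nu> f z)} \<in> sets disc_area" by measurable
      then show "{z \<in> ball 0 1. \<tau> < norm (T_op \<nu> f z)} \<in> sets disc_area" by simp
    qed
    also have "\<dots> \<le> x powr q / \<tau> powr q" using x \<tau> by (simp add: weak_bounds_def)
    also have "\<dots> \<le> D powr q / \<tau> powr q"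
      using x q by (intro divide_right_mono powr_mono2) (auto simp: weak_bounds_def)
    also have "\<dots> = (D / \<tau>) powr q"
      using \<tau> by (simp add: powr_divide D_def)
    finally have "m powr (1 / q) \<le> ((D / \<tau>) powr q) powr (1 / q)"
      using m q(1) by (intro powr_mono2) auto
    also have "\<dots> = D / \<tau>" using q(1) \<tau> by (simp add: powr_powr D_def)
    finally have "\<tau> \<le> D / m powr (1 / q)" using \<tau> m by (simp add: field_simps)
    also have "\<dots> = (\<bar>C\<bar> + 1) * m powr (1 - 1 / c)"
    proof -
      have e: "1 - 1 / c = 1 / p - 1 / q" using q(2) by simp
      show ?thesis unfolding e D_def powr_diff by simp
    qed
    also have "\<dots> \<le> (\<bar>C\<bar> + 1) * (t\<^sup>2) powr (1 - 1 / c)"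
      using c m t by (intro mult_left_mono powr_mono2) (auto simp: m_def power2_eq_square)
    also have "(t\<^sup>2) powr (1 - 1 / c) = t * t powr (1 - 2 / c)"
    proof -
      have "(t\<^sup>2) powr (1 - 1 / c) = t powr (1 + (1 - 2 / c))"
        using t by (simp add: powr_powr algebra_simps flip: powr_numeral)
      then show ?thesis using t by (simp only: powr_add) simp
    qed
    finally have "t * N \<le> t * (6400 * (\<bar>C\<bar> + 1) * t powr (1 - 2 / c))"
      by (simp add: \<tau>_def algebra_simps)
    then show ?thesis using t by (simp add: N_def)
  qed simp
  then show ?thesis unfolding Stieltjes_growth_def by (intro exI[of _ "6400 * (\<bar>C\<bar> + 1)"]) auto
qed

theorem bounded_of_Stieltjes_growth:
  assumes p: "1 < p" and c: "1 \<le> c" and q: "0 < q" "1 / q = 1 / p + 1 / c - 1"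
    and "Stieltjes_growth c \<nu>"
  shows "bounded_Lp_Lq (T_op \<nu>) p q"
proof -
  from assms(5) obtain B where "\<forall>t\<in>{0<..1}. Stieltjes \<nu> t \<le> B * t powr (1 - 2 / c)"
    unfolding Stieltjes_growth_def by blast
  then have B: "\<And>t. 0 < t \<Longrightarrow> t \<le> 1 \<Longrightarrow> Stieltjes \<nu> t \<le> B * t powr (1 - 2 / c)" by simp
  have "0 \<le> 6 * B" using B[of 1] Stieltjes_nonneg[of 1] by simp
  then show ?thesis
    using p c q T_kernel_bound[OF c B] by (intro bounded_Lp_Lq_of_kernel_bound[of p c q "6 * B"]) auto
qed
end

text \<open>
  Chebyshev's inequality. Admissible constants of the weak quasi-norm are positive, so a vanishing
  $L^q$ norm is not itself admissible, and the infimum is compared through every larger constant.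
\<close>
lemma bounded_Lp_weak_Lq_of_bounded_Lp_Lq:
  assumes q: "0 < q" and strong: "bounded_Lp_Lq T p q"
  shows "bounded_Lp_weak_Lq T p q"
proof -
  from strong obtain C where C: "\<And>f. f \<in> Lp_disc p \<Longrightarrow> T f \<in> Lp_disc q \<and> Lp_norm q (T f) \<le> C * Lp_norm p f"
    unfolding bounded_Lp_Lq_def by blast
  have "T f \<in> weak_Lp_disc q \<and> weak_Lp_norm q (T f) \<le> C * Lp_norm p f" if f: "f \<in> Lp_disc p" for f
  proof -
    define g where "g = T f"
    have g: "g \<in> Lp_disc q" using C[OF f] by (simp add: g_def)
    then have gm[measurable]: "g \<in> borel_measurable disc_area" and gi: "integrable disc_area (\<lambda>z. norm (g z) powr q)"
      by (auto simp: Lp_disc_def)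
    define I where "I = (LINT z|disc_area. norm (g z) powr q)"
    have I: "0 \<le> I" by (simp add: I_def)
    have mem: "x \<in> weak_bounds q g" if x: "0 < x" "Lp_norm q g \<le> x" for x
    proof -
      have "measure disc_area {z \<in> ball 0 1. t < norm (g z)} \<le> x powr q / t powr q" if t: "0 < t" for t
      proof -
        have "measure disc_area {z \<in> ball 0 1. t < norm (g z)}
          \<le> measure disc_area {z \<in> space disc_area. t powr q \<le> norm (g z) powr q}"
        proof (rule disc_area.finite_measure_mono)
          show "{z \<in> ball 0 1. t < norm (g z)} \<subseteq> {z \<in> space disc_area. t powr q \<le> norm (g z) powr q}"
            using t q by (auto intro!: powr_mono2)
          show "{z \<in> space disc_area. t powr q \<le> norm (g z) powr q} \<in> sets disc_area" by measurable
        qed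
        also have "\<dots> \<le> I / t powr q"
          unfolding I_def by (rule integral_Markov_inequality_measure[OF gi, where A="{}"]) (use t in auto)
        also have "I \<le> x powr q"
        proof -
          have "(I powr (1 / q)) powr q \<le> x powr q"
            using x q by (intro powr_mono2) (auto simp: Lp_norm_def I_def)
          then show ?thesis using I q by (simp add: powr_powr)
        qed
        finally show ?thesis using t by (simp add: divide_right_mono)
      qed
      then show ?thesis using x by (simp add: weak_bounds_def)
    qed
    have n0: "0 \<le> Lp_norm q g" by (simp add: Lp_norm_def)
    have bdd: "bdd_below (weak_bounds q g)" by (intro bdd_belowI[of _ 0]) (auto simp: weak_bounds_def)
    have "Inf (weak_bounds q g) \<le> Lp_norm q g"
    proof (rule field_le_epsilon)
      fix e :: real assume "0 < e"
      then show "Inf (weak_bounds q g) \<le> Lp_norm q g + e"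
        using n0 by (intro cInf_lower bdd mem) auto
    qed
    moreover have "weak_bounds q g \<noteq> {}" using mem[of "Lp_norm q g + 1"] n0 by auto
    ultimately show ?thesis using C[OF f] gm
      by (auto simp: weak_Lp_norm_def weak_Lp_disc_def g_def)
  qed
  then show ?thesis unfolding bounded_Lp_weak_Lq_def by blast
qed

section \<open>Carleson measures and hyperbolic integrability\<close>

text \<open>Already the least $k$ with $x \le 2^k\delta$ contributes enough.\<close>

lemma dyadic_majorant:
  fixes x \<delta> :: real
  assumes x: "0 \<le> x" and \<delta>: "0 < \<delta>"
  shows "ennreal (1 / (x + \<delta>)) \<le> (\<Sum>k. ennreal (2 / (2 ^ k * \<delta>)) * indicator {..2 ^ k * \<delta>} x)"
proof -
  have "\<exists>k::nat. x \<le> 2 ^ k * \<delta>"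
  proof -
    obtain k :: nat where "x / \<delta> < 2 ^ k" using real_arch_pow[of 2 "x / \<delta>"] by auto
    then show ?thesis using \<delta> by (auto simp: field_simps intro!: exI[of _ k])
  qed
  define k where "k = (LEAST k. x \<le> 2 ^ k * \<delta>)"
  have k: "x \<le> 2 ^ k * \<delta>" unfolding k_def using \<open>\<exists>k. _\<close> by (rule LeastI_ex)
  have "2 ^ k * \<delta> \<le> 2 * (x + \<delta>)"
  proof (cases k)
    case (Suc n)
    then have "\<not> x \<le> 2 ^ n * \<delta>" using not_less_Least[of n "\<lambda>k. x \<le> 2 ^ k * \<delta>"] by (simp add: k_def)
    then show ?thesis using Suc \<delta> by simp
  qed (use x \<delta> in simp)
  then have le: "1 / (x + \<delta>) \<le> 2 / (2 ^ k * \<delta>)"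
    using x \<delta> by (simp add: field_simps)
  define g where "g i = ennreal (2 / (2 ^ i * \<delta>)) * indicator {..2 ^ i * \<delta>} x" for i
  have "ennreal (1 / (x + \<delta>)) \<le> g k"
    using k le by (simp add: ennreal_leI g_def)
  also have "\<dots> = (\<Sum>i\<in>{k}. g i)" by simp
  also have "\<dots> \<le> (\<Sum>i. g i)"
    by (rule sum_le_suminf) auto
  finally show ?thesis unfolding g_def .
qed

context unit_interval_measure
begin

lemma interval_sets_nu: "0 \<le> a \<Longrightarrow> {a..<1} \<in> sets \<nu>" "0 \<le> a \<Longrightarrow> {a..1} \<in> sets \<nu>" "{1} \<in> sets \<nu>"
  by (auto simp: sets_nu sets_restrict_space_iff)

lemma emeasure_interval_eq:
  assumes atom: "emeasure \<nu> {1} = 0" and a: "0 \<le> a" "a \<le> 1"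
  shows "emeasure \<nu> {a..1} = emeasure \<nu> {a..<1}"
proof -
  have "{a..1} = {a..<1} \<union> {1}" using a by auto
  then have "emeasure \<nu> {a..1} = emeasure \<nu> {a..<1} + emeasure \<nu> {1}"
    using a by (simp only:) (rule plus_emeasure[symmetric], auto intro: interval_sets_nu)
  then show ?thesis using atom by simp
qed

lemma carleson_condition_bound:
  assumes "carleson_condition \<alpha> \<nu>"
  obtains C where "0 \<le> C" "\<And>t. 0 < t \<Longrightarrow> t \<le> 1 \<Longrightarrow> emeasure \<nu> {1 - t..<1} \<le> ennreal (C * t powr \<alpha>)"
proof -
  define S where "S = (SUP t\<in>{0<..1}. emeasure \<nu> {1 - t..<1} / ennreal (t powr \<alpha>))"
  have "S < \<infinity>" using assms by (simp add: carleson_condition_def S_def)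
  then obtain C where C: "S = ennreal C" "0 \<le> C" by (cases S) auto
  have "emeasure \<nu> {1 - t..<1} \<le> ennreal (C * t powr \<alpha>)" if t: "0 < t" "t \<le> 1" for t
  proof -
    have "emeasure \<nu> {1 - t..<1} / ennreal (t powr \<alpha>) \<le> ennreal C"
      unfolding C(1)[symmetric] S_def using t by (intro SUP_upper) auto
    then have "emeasure \<nu> {1 - t..<1} / ennreal (t powr \<alpha>) * ennreal (t powr \<alpha>) \<le> ennreal C * ennreal (t powr \<alpha>)"
      by (rule mult_right_mono) simp
    moreover have "emeasure \<nu> {1 - t..<1} / ennreal (t powr \<alpha>) * ennreal (t powr \<alpha>) = emeasure \<nu> {1 - t..<1}"
      using t by (intro ennreal_divide_times[THEN trans] ) (auto simp: ennreal_mult_divide_eq)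
    ultimately show ?thesis using C by (simp add: ennreal_mult)
  qed
  with C(2) show ?thesis by (rule that)
qed

text \<open>
  Integrating the dyadic majorant of $\frac1{x+\delta}$ at $x = 1-r$ gives a geometric series with
  ratio $2^{\alpha-1} < 1$. An atom at $1$ has to be excluded because the Carleson condition does not
  see it.
\<close>
lemma Stieltjes_growth_of_Carleson:
  assumes c: "1 < c" "c < 2" and atom: "emeasure \<nu> {1} = 0"
    and carleson: "carleson_condition (2 - 2 / c) \<nu>"
  shows "Stieltjes_growth c \<nu>"
proof -
  define \<alpha> where "\<alpha> = 2 - 2 / c"
  have \<alpha>: "0 < \<alpha>" "\<alpha> < 1" using c by (auto simp: \<alpha>_def field_simps)
  obtain C where C: "0 \<le> C" "\<And>t. 0 < t \<Longrightarrow> t \<le> 1 \<Longrightarrow> emeasure \<nu> {1 - t..<1} \<le> ennreal (C * t powr \<alpha>)"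
    using carleson_condition_bound[OF carleson] unfolding \<alpha>_def by metis
  have C': "emeasure \<nu> {r \<in> space \<nu>. 1 - r \<le> t} \<le> ennreal (C * t powr \<alpha>)" if t: "0 < t" for t
  proof (cases "t \<le> 1")
    case True
    then have "{r \<in> space \<nu>. 1 - r \<le> t} = {1 - t..1}" using t by (auto simp: space_nu)
    then show ?thesis using C(2)[OF t True] emeasure_interval_eq[OF atom, of "1 - t"] t True by simp
  next
    \<comment> \<open>Beyond the range of the Carleson condition the set is the whole interval, which is the case $t = 1$.\<close>
    case False
    then have "{r \<in> space \<nu>. 1 - r \<le> t} = {1 - 1..1}" using t by (auto simp: space_nu)
    then have "emeasure \<nu> {r \<in> space \<nu>. 1 - r \<le> t} \<le> ennreal (C * 1 powr \<alpha>)"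
      using C(2)[of 1] emeasure_interval_eq[OF atom, of "1 - 1"] by simp
    also have "\<dots> \<le> ennreal (C * t powr \<alpha>)"
      using C(1) False \<alpha> by (intro ennreal_leI mult_left_mono powr_mono2) auto
    finally show ?thesis .
  qed
  define \<rho> where "\<rho> = 2 powr (\<alpha> - 1)"
  have \<rho>: "0 < \<rho>" "\<rho> < 1" using \<alpha> by (auto simp: \<rho>_def powr_less_one)
  have "Stieltjes \<nu> \<delta> \<le> 2 * C / (1 - \<rho>) * \<delta> powr (1 - 2 / c)" if \<delta>: "0 < \<delta>" for \<delta>
  proof -
    have "ennreal (Stieltjes \<nu> \<delta>) = (\<integral>\<^sup>+r. ennreal (1 / ((1 - r) + \<delta>)) \<partial>\<nu>)"
      using \<delta> by (rule ennreal_Stieltjes)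
    also have "\<dots> \<le> (\<integral>\<^sup>+r. (\<Sum>k. ennreal (2 / (2 ^ k * \<delta>)) * indicator {..2 ^ k * \<delta>} (1 - r)) \<partial>\<nu>)"
      using \<delta> by (intro nn_integral_mono dyadic_majorant) (auto simp: space_nu)
    also have "\<dots> = (\<Sum>k. \<integral>\<^sup>+r. ennreal (2 / (2 ^ k * \<delta>)) * indicator {..2 ^ k * \<delta>} (1 - r) \<partial>\<nu>)"
      by (rule nn_integral_suminf) measurable
    also have "\<dots> \<le> (\<Sum>k. ennreal (2 * C * \<delta> powr (\<alpha> - 1) * \<rho> ^ k))"
    proof (intro suminf_le allI)
      fix k
      have "(\<integral>\<^sup>+r. ennreal (2 / (2 ^ k * \<delta>)) * indicator {..2 ^ k * \<delta>} (1 - r) \<partial>\<nu>)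
        = (\<integral>\<^sup>+r. ennreal (2 / (2 ^ k * \<delta>)) * indicator {r \<in> space \<nu>. 1 - r \<le> 2 ^ k * \<delta>} r \<partial>\<nu>)"
        by (intro nn_integral_cong) (auto simp: indicator_def)
      also have "\<dots> = ennreal (2 / (2 ^ k * \<delta>)) * emeasure \<nu> {r \<in> space \<nu>. 1 - r \<le> 2 ^ k * \<delta>}"
        by (rule nn_integral_cmult_indicator) measurable
      also have "\<dots> \<le> ennreal (2 / (2 ^ k * \<delta>)) * ennreal (C * (2 ^ k * \<delta>) powr \<alpha>)"
        using \<delta> by (intro mult_left_mono C') auto
      also have "\<dots> = ennreal (2 * C * ((2 ^ k * \<delta>) powr \<alpha> / (2 ^ k * \<delta>)))"
        using \<delta> C(1) by (simp add: ennreal_mult[symmetric] mult_ac)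
      also have "(2 ^ k * \<delta>) powr \<alpha> / (2 ^ k * \<delta>) = (2 ^ k * \<delta>) powr (\<alpha> - 1)"
        using \<delta> by (simp add: powr_diff)
      also have "\<dots> = \<delta> powr (\<alpha> - 1) * \<rho> ^ k"
        using \<delta> by (simp add: \<rho>_def powr_mult powr_powr powr_realpow[symmetric] mult_ac)
      finally show "(\<integral>\<^sup>+r. ennreal (2 / (2 ^ k * \<delta>)) * indicator {..2 ^ k * \<delta>} (1 - r) \<partial>\<nu>)
        \<le> ennreal (2 * C * \<delta> powr (\<alpha> - 1) * \<rho> ^ k)" by (simp add: mult_ac)
    qed auto
    also have "\<dots> = ennreal (2 * C * \<delta> powr (\<alpha> - 1) * (1 / (1 - \<rho>)))"
      using \<rho> C(1) by (intro suminf_ennreal_eq sums_mult geometric_sums) auto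
    also have "\<alpha> - 1 = 1 - 2 / c" by (simp add: \<alpha>_def)
    finally have "Stieltjes \<nu> \<delta> \<le> 2 * C * \<delta> powr (1 - 2 / c) * (1 / (1 - \<rho>))"
      using \<rho> C(1) by (subst (asm) ennreal_le_iff) auto
    then show ?thesis by (simp add: mult_ac)
  qed
  then show ?thesis unfolding Stieltjes_growth_def by (intro exI[of _ "2 * C / (1 - \<rho>)"]) auto
qed

text \<open>For $c = 1$ growth is the trivial bound $N(t) \le \nu([0,1])/t$.\<close>

lemma Stieltjes_growth_1: "Stieltjes_growth 1 \<nu>"
proof -
  have "Stieltjes \<nu> t \<le> measure \<nu> (space \<nu>) * t powr (1 - 2 / 1)" if t: "0 < t" for t
  proof -
    have "Stieltjes \<nu> t \<le> (LINT r|\<nu>. 1 / t)"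
      unfolding Stieltjes_def using t
      by (intro integral_mono Stieltjes_integrable divide_left_mono mult_pos_pos) (auto simp: space_nu)
    then show ?thesis using t by (simp add: powr_minus divide_inverse)
  qed
  then show ?thesis unfolding Stieltjes_growth_def by (intro exI[of _ "measure \<nu> (space \<nu>)"]) auto
qed

text \<open>On $[1-t,1)$ the integrand of $N(t)$ is at least $\frac1{2t}$.\<close>

lemma Carleson_of_Stieltjes_growth:
  assumes "Stieltjes_growth c \<nu>"
  shows "carleson_condition (2 - 2 / c) \<nu>"
proof -
  from assms obtain B where B: "\<forall>t\<in>{0<..1}. Stieltjes \<nu> t \<le> B * t powr (1 - 2 / c)"
    unfolding Stieltjes_growth_def by blast
  have "emeasure \<nu> {1 - t..<1} / ennreal (t powr (2 - 2 / c)) \<le> ennreal (2 * B)" if t: "t \<in> {0<..1}" for t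
  proof -
    have t': "0 < t" "t \<le> 1" using t by auto
    have B0: "0 \<le> B" using B Stieltjes_nonneg[of 1] by (auto dest: bspec[of _ _ 1])
    have "emeasure \<nu> {1 - t..<1} = (\<integral>\<^sup>+r. indicator {1 - t..<1} r \<partial>\<nu>)"
      using t' by (intro nn_integral_indicator[symmetric] interval_sets_nu) auto
    also have "\<dots> \<le> (\<integral>\<^sup>+r. ennreal (2 * t) * ennreal (1 / (1 - r + t)) \<partial>\<nu>)"
      using t' by (intro nn_integral_mono)
        (auto simp: indicator_def space_nu ennreal_mult[symmetric] divide_simps simp flip: ennreal_1 intro!: ennreal_leI)
    also have "\<dots> = ennreal (2 * t) * ennreal (Stieltjes \<nu> t)"
      using t' by (simp add: nn_integral_cmult ennreal_Stieltjes)
    also have "\<dots> = ennreal (2 * t * Stieltjes \<nu> t)"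
      using t' Stieltjes_nonneg by (simp add: ennreal_mult)
    also have "\<dots> \<le> ennreal (2 * t * (B * t powr (1 - 2 / c)))"
      using t t' B by (intro ennreal_leI mult_left_mono) auto
    also have "2 * t * (B * t powr (1 - 2 / c)) = 2 * B * t powr (2 - 2 / c)"
      using t' powr_add[of t 1 "1 - 2 / c"] by simp
    finally have "emeasure \<nu> {1 - t..<1} / ennreal (t powr (2 - 2 / c)) \<le> ennreal (2 * B * t powr (2 - 2 / c)) / ennreal (t powr (2 - 2 / c))"
      by (rule divide_right_mono_ennreal)
    also have "\<dots> = ennreal (2 * B)"
      using t' B0 by (subst divide_ennreal) auto
    finally show ?thesis .
  qed
  then have "(SUP t\<in>{0<..1}. emeasure \<nu> {1 - t..<1} / ennreal (t powr (2 - 2 / c))) \<le> ennreal (2 * B)"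
    by (intro SUP_least)
  then show ?thesis unfolding carleson_condition_def by (rule le_less_trans) simp
qed

lemma hyperbolic_integrable_of_Stieltjes_growth:
  assumes "Stieltjes_growth 2 \<nu>"
  shows "hyperbolic_integrable \<nu>"
proof -
  from assms obtain B where B: "\<forall>t\<in>{0<..1}. Stieltjes \<nu> t \<le> B * t powr (1 - 2 / 2)"
    unfolding Stieltjes_growth_def by blast
  define u where "u n r = ennreal (1 / (1 - r + 1 / real (Suc n)))" for n r
  have "(\<integral>\<^sup>+r\<in>{0..<1}. ennreal (1 / (1 - r\<^sup>2)) \<partial>\<nu>) \<le> (\<integral>\<^sup>+r. liminf (\<lambda>n. u n r) \<partial>\<nu>)"
  proof (rule nn_integral_mono)
    fix r assume "r \<in> space \<nu>"
    show "ennreal (1 / (1 - r\<^sup>2)) * indicator {0..<1} r \<le> liminf (\<lambda>n. u n r)"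
    proof (cases "r \<in> {0..<1}")
      case True
      have "(\<lambda>n. 1 / (1 - r + 1 / real (Suc n))) \<longlonglongrightarrow> 1 / (1 - r + 0)"
        using True by (intro tendsto_intros LIMSEQ_Suc[OF lim_1_over_n]) auto
      then have "(\<lambda>n. u n r) \<longlonglongrightarrow> ennreal (1 / (1 - r))"
        unfolding u_def by (intro tendsto_ennrealI) simp
      then have "liminf (\<lambda>n. u n r) = ennreal (1 / (1 - r))" by (intro lim_imp_Liminf) auto
      moreover have "1 / (1 - r\<^sup>2) \<le> 1 / (1 - r)"
        using True mult_left_le[of r r] by (intro divide_left_mono mult_pos_pos) (auto simp: power2_eq_square abs_square_less_1 simp flip: power2_eq_square)
      ultimately show ?thesis using True by (simp add: ennreal_leI)
    qed simp
  qed
  also have "\<dots> \<le> liminf (\<lambda>n. \<integral>\<^sup>+r. u n r \<partial>\<nu>)"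
    by (rule nn_integral_liminf) (simp add: u_def)
  also have "\<dots> \<le> liminf (\<lambda>n::nat. ennreal B)"
  proof (intro Liminf_mono always_eventually allI)
    fix n
    have "(\<integral>\<^sup>+r. u n r \<partial>\<nu>) = ennreal (Stieltjes \<nu> (1 / real (Suc n)))"
      unfolding u_def by (rule ennreal_Stieltjes[symmetric]) simp
    also have "\<dots> \<le> ennreal B" using B by (intro ennreal_leI) auto
    finally show "(\<integral>\<^sup>+r. u n r \<partial>\<nu>) \<le> ennreal B" .
  qed
  also have "\<dots> < \<infinity>" by (simp add: Liminf_const)
  finally show ?thesis by (simp add: hyperbolic_integrable_def)
qed

lemma Stieltjes_growth_of_hyperbolic_integrable:
  assumes atom: "emeasure \<nu> {1} = 0" and hyp: "hyperbolic_integrable \<nu>"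
  shows "Stieltjes_growth 2 \<nu>"
proof -
  define H where "H = (\<integral>\<^sup>+r\<in>{0..<1}. ennreal (1 / (1 - r\<^sup>2)) \<partial>\<nu>)"
  have "H < \<infinity>" using hyp by (simp add: H_def hyperbolic_integrable_def)
  then obtain h where h: "H = ennreal h" "0 \<le> h" by (cases H) auto
  have "Stieltjes \<nu> t \<le> 2 * h" if t: "0 < t" for t
  proof -
    have "AE r in \<nu>. r \<noteq> 1"
      by (rule AE_I[of _ _ "{1}"]) (auto intro: atom interval_sets_nu)
    then have "AE r in \<nu>. ennreal (1 / (1 - r + t)) \<le> ennreal 2 * (ennreal (1 / (1 - r\<^sup>2)) * indicator {0..<1} r)"
    proof (rule AE_mp, intro AE_I2 impI)
      fix r assume "r \<in> space \<nu>" "r \<noteq> 1"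
      then have r: "0 \<le> r" "r < 1" by (auto simp: space_nu)
      have "1 / (1 - r + t) \<le> 1 / (1 - r)" using r t by (intro divide_left_mono) auto
      also have "\<dots> = 2 * (1 / (2 * (1 - r)))" using r by (simp add: field_simps)
      also have "\<dots> \<le> 2 * (1 / (1 - r\<^sup>2))"
      proof (intro mult_left_mono divide_left_mono mult_pos_pos)
        have "1 - r\<^sup>2 = (1 - r) * (1 + r)" by (simp add: power2_eq_square algebra_simps)
        also have "\<dots> \<le> (1 - r) * 2" using r by (intro mult_left_mono) auto
        finally show "1 - r\<^sup>2 \<le> 2 * (1 - r)" by simp
        show "0 < 1 - r\<^sup>2" using r by (simp add: power_less_one_iff)
      qed (use r in auto)
      finally show "ennreal (1 / (1 - r + t)) \<le> ennreal 2 * (ennreal (1 / (1 - r\<^sup>2)) * indicator {0..<1} r)"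
        using r by (simp add: ennreal_mult'[symmetric] ennreal_leI del: ennreal_numeral)
    qed
    then have "(\<integral>\<^sup>+r. ennreal (1 / (1 - r + t)) \<partial>\<nu>) \<le> (\<integral>\<^sup>+r. ennreal 2 * (ennreal (1 / (1 - r\<^sup>2)) * indicator {0..<1} r) \<partial>\<nu>)"
      by (rule nn_integral_mono_AE)
    also have "\<dots> = ennreal 2 * H"
      unfolding H_def by (rule nn_integral_cmult) measurable
    also have "\<dots> = ennreal (2 * h)" unfolding h(1) by (rule ennreal_mult'[symmetric]) simp
    finally show ?thesis
      unfolding ennreal_Stieltjes[OF t, symmetric] using h by (subst (asm) ennreal_le_iff) auto
  qed
  then show ?thesis unfolding Stieltjes_growth_def by (intro exI[of _ "2 * h"]) auto
qed

text \<open>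
  Some $c > 1$ has a finite integral, and the weight for this $c$ is infinite at $1$.
\<close>
lemma no_atom_of_critical_index:
  assumes "1 < critical_index \<nu>"
  shows "emeasure \<nu> {1} = 0"
proof -
  let ?S = "{c. 1 \<le> c \<and> c < 2 \<and> (\<integral>\<^sup>+ r. radial_weight (two_over_dual c) r \<partial>\<nu>) < \<infinity>}"
  have "?S \<noteq> {}"
  proof
    assume "?S = {}"
    moreover have "1 \<in> ?S"
      using emeasure_finite[of "space \<nu>"]
      by (simp add: radial_weight_def two_over_dual_def dual_exponent_def less_top[symmetric])
    ultimately show False by blast
  qed
  then obtain c where c: "c \<in> ?S" "1 < c"
    using assms less_cSupD[of ?S 1] unfolding critical_index_def by auto
  define s where "s = two_over_dual c"
  have s: "s \<noteq> 0" using c by (simp add: s_def two_over_dual_def dual_exponent_def)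
  have "\<infinity> * emeasure \<nu> {1} = (\<integral>\<^sup>+r. \<infinity> * indicator {1} r \<partial>\<nu>)"
    by (rule nn_integral_cmult_indicator[symmetric]) (rule interval_sets_nu)
  also have "\<dots> \<le> (\<integral>\<^sup>+r. radial_weight s r \<partial>\<nu>)"
    by (intro nn_integral_mono) (auto simp: indicator_def radial_weight_def s)
  also have "\<dots> < \<infinity>" using c by (simp add: s_def)
  finally show ?thesis by (auto simp: ennreal_top_mult split: if_splits)
qed

end

lemma two_over_dual_eq:
  assumes "1 \<le> c" shows "two_over_dual c = 2 - 2 / c"
  using assms by (auto simp: two_over_dual_def dual_exponent_def field_simps)

section \<open>The equivalences\<close>

theorem theorem6p1:
  fixes \<nu> :: "real measure" and p q :: real
  assumes "sets \<nu> = sets (restrict_space borel {0..1})"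
    and "finite_measure \<nu>"
    and "1 < p"
    and "ereal p < dual_exponent (critical_index \<nu>)"
    and "1 / q = 1 / p + 1 / critical_index \<nu> - 1"
  shows "(1 \<le> critical_index \<nu> \<and> critical_index \<nu> < 2 \<longrightarrow>
           (bounded_Lp_weak_Lq (T_op \<nu>) p q \<longleftrightarrow> bounded_Lp_Lq (T_op \<nu>) p q) \<and>
           (bounded_Lp_Lq (T_op \<nu>) p q \<longleftrightarrow>
              carleson_condition (two_over_dual (critical_index \<nu>)) \<nu>)) \<and>
         (critical_index \<nu> = 2 \<longrightarrow>
           p < 2 \<and> q = 2 * p / (2 - p) \<and>
           (bounded_Lp_weak_Lq (T_op \<nu>) p q \<longleftrightarrow> bounded_Lp_Lq (T_op \<nu>) p q) \<and>
           (bounded_Lp_Lq (T_op \<nu>) p q \<longleftrightarrow> hyperbolic_integrable \<nu>))"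
proof -
  interpret unit_interval_measure \<nu> by (rule unit_interval_measure.intro) fact+
  define c where "c = critical_index \<nu>"
  have c: "1 \<le> c" "c \<le> 2" unfolding c_def by (rule critical_index_bounds[OF assms(2)])+
  note p = \<open>1 < p\<close>
  have q_eq: "1 / q = 1 / p + 1 / c - 1" using assms(5) by (simp add: c_def)
  have pc: "p < c / (c - 1)" if "c \<noteq> 1"
    using assms(4) that by (simp add: dual_exponent_def c_def)
  have "0 < 1 / q"
  proof (cases "c = 1")
    case True
    then show ?thesis using q_eq p by simp
  next
    case False
    then have "p * (c - 1) < c" using pc c by (simp add: pos_less_divide_eq)
    then have "0 < (c - p * (c - 1)) / (p * c)" using p c by simp
    also have "\<dots> = 1 / q" unfolding q_eq using p c by (simp add: field_simps)
    finally show ?thesis .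
  qed
  then have q: "0 < q" by simp
  have strong: "bounded_Lp_Lq (T_op \<nu>) p q \<longleftrightarrow> Stieltjes_growth c \<nu>"
    and weak: "bounded_Lp_weak_Lq (T_op \<nu>) p q \<longleftrightarrow> Stieltjes_growth c \<nu>"
    using bounded_of_Stieltjes_growth[OF p c(1) q q_eq] Stieltjes_growth_of_weak_type[OF p c(1) q q_eq]
      bounded_Lp_weak_Lq_of_bounded_Lp_Lq[OF q, of "T_op \<nu>" p] by blast+
  have "Stieltjes_growth c \<nu> \<longleftrightarrow> carleson_condition (two_over_dual c) \<nu>" if "c < 2"
  proof (cases "c = 1")
    case True
    then show ?thesis
      using Stieltjes_growth_1 Carleson_of_Stieltjes_growth[OF Stieltjes_growth_1] by (simp add: two_over_dual_eq)
  next
    case False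
    then show ?thesis
      using that c Stieltjes_growth_of_Carleson[of c] Carleson_of_Stieltjes_growth[of c] no_atom_of_critical_index
      by (auto simp: two_over_dual_eq c_def)
  qed
  moreover have "Stieltjes_growth c \<nu> \<longleftrightarrow> hyperbolic_integrable \<nu>" if "c = 2"
    using that hyperbolic_integrable_of_Stieltjes_growth Stieltjes_growth_of_hyperbolic_integrable no_atom_of_critical_index
    by (auto simp: c_def)
  moreover have "p < 2 \<and> q = 2 * p / (2 - p)" if "c = 2"
  proof -
    have "p < 2" using pc that by simp
    moreover have "1 / q = (2 - p) / (2 * p)" using q_eq that p by (simp add: field_simps)
    then have "q = 2 * p / (2 - p)" by (metis inverse_divide inverse_eq_divide inverse_inverse_eq)
    ultimately show ?thesis by simp
  qed
  ultimately show ?thesis unfolding strong weak c_def[symmetric] by blast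
qed

end
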